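(* Let $s\ge 2$ be an integer and let $\kappa_0,\kappa_1\in\mathbb{C}$ be such that none of $-\kappa_0+\frac12$, $-\kappa_1+\frac12$, $-s(\kappa_0+\kappa_1)$ is a positive integer. Suppose $a>b\ge 0$ are integers with $a-b\equiv t \pmod s$, where $1\le t<s$. Write $b=vs+r$ with $v\ge 0$ and $0\le r<s$, and $a=us+r+t$. Then $$\begin{aligned}V(z^a\overline z^b)={}&a!\,b!\sum_{k=0}^{v}\frac{\lambda_{u+v-2k}\; c(f_{u+v-2k};u-k,v-k)}{(ks+r)!\,(s\kappa_0+s\kappa_1+1)_{a+(v-k)s}}\,(z\overline z)^{ks+r}z^{t}f_{u+v-2k}(z^s)\\&+a!\,b!\sum_{k=1-\lfloor (r+t)/s\rfloor}^{v}\frac{\lambda_{u+v+1-2k}\; c(f_{u+v+1-2k};v-k,u-k+1)}{((k-1)s+r+t)!\,(s\kappa_0+s\kappa_1+1)_{b+(u-k+1)s}}\,(z\overline z)^{(k-1)s+r+t}\,\overline z^{\,s-t}f_{u+v+1-2k}(\overline z^s).\end{aligned}$$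
   Context: Notation: $(x)_n=x(x+1)\cdots(x+n-1)$, $(x)_0=1$. Polynomials are in $z=x_1+\mathrm{i}x_2$, $\overline z=x_1-\mathrm{i}x_2$; $f(z)$ abbreviates $f(z,\overline z)$; $f(z^s)$ means $f$ with $(z,\overline z)$ replaced by $(z^s,\overline z^s)$, $f(\overline z^s)$ means $f$ with $(z,\overline z)$ replaced by $(\overline z^s,z^s)$, and for a unimodular number $\eta$, $f(\overline z\eta)$ means $f(\overline z\eta,z\eta^{-1})$. For a polynomial $f$, $c(f;a,b)$ is the coefficient of $z^a\overline z^b$ in $f$ (zero if $a<0$ or $b<0$). Empty sums are $0$. Operators (dihedral group $I_2(2s)$): with $\omega=e^{\mathrm{i}\pi/s}$, for polynomials $f$, $$Tf(z)=\frac{\partial f}{\partial z}+\kappa_0\sum_{j=0}^{s-1}\frac{f(z)-f(\overline z\omega^{2j})}{z-\overline z\omega^{2j}}+\kappa_1\sum_{j=0}^{s-1}\frac{f(z)-f(\overline z\omega^{2j+1})}{z-\overline z\omega^{2j+1}},$$ $$\overline Tf(z)=\frac{\partial f}{\partial\overline z}-\kappa_0\sum_{j=0}^{s-1}\frac{f(z)-f(\overline z\omega^{2j})}{z-\overline z\omega^{2j}}\omega^{2j}-\kappa_1\sum_{j=0}^{s-1}\frac{f(z)-f(\overline z\omega^{2j+1})}{z-\overline z\omega^{2j+1}}\omega^{2j+1}.$$ The intertwining operator $V$ is the unique linear map on polynomials in $z,\overline z$ that maps homogeneous polynomials to homogeneous polynomials of the same degree and satisfies $TVf=V\frac{\partial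 f}{\partial z}$, $\overline TVf=V\frac{\partial f}{\partial\overline z}$, $V1=1$. Polynomials $f_n$: let $P_n^{(\alpha,\beta)}(x)=\frac1{n!}\sum_{l=0}^n\frac{(-n)_l(n+\alpha+\beta+1)_l(\alpha+1+l)_{n-l}}{l!}\left(\frac{1-x}{2}\right)^l$ be the Jacobi polynomials, $P_{-1}^{(\alpha,\beta)}=0$, and put $x=\frac{z^2+\overline z^2}{2z\overline z}$ (so $x=\cos 2\theta$ if $z=re^{\mathrm{i}\theta}$). For $n\ge0$, $$f_{2n}=(z\overline z)^nP_n^{(\kappa_0-\frac12,\kappa_1-\frac12)}(x)+\tfrac14(z^2-\overline z^2)(z\overline z)^{n-1}P_{n-1}^{(\kappa_0+\frac12,\kappa_1+\frac12)}(x),$$ $$f_{2n+1}=\left(n+\kappa_0+\tfrac12\right)\tfrac{z+\overline z}{2}(z\overline z)^nP_n^{(\kappa_0-\frac12,\kappa_1+\frac12)}(x)+\left(n+\kappa_1+\tfrac12\right)\tfrac{z-\overline z}{2}(z\overline z)^nP_n^{(\kappa_0+\frac12,\kappa_1-\frac12)}(x).$$ These are polynomials in $z,\overline z$, homogeneous of degree equal to the subscript. Structural constants, for $n\ge0$: $$\lambda_{2n}=\frac{n!\,(\kappa_0+\kappa_1+1)_n}{(\kappa_0+\frac12)_n(\kappa_1+\frac12)_n},\qquad \lambda_{2n+1}=\frac{n!\,(\kappa_0+\kappa_1+1)_n}{(\kappa_0+\frac12)_{n+1}(\kappa_1+\frac12)_{n+1}}.$$ *)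

theory Defs
  imports Complex_Main "HOL-Computational_Algebra.Computational_Algebra"
begin

text \<open>
  Polynomials in the two indeterminates z and zbar are elements of C[z][zbar]: the inner
  indeterminate is z, the outer one is zbar.
\<close>

type_synonym zpoly = "complex poly poly"

definition Z :: zpoly where "Z = [:[:0, 1:]:]"

definition Zbar :: zpoly where "Zbar = [:0, 1:]"

abbreviation const :: "complex \<Rightarrow> zpoly" where "const c \<equiv> [:[:c:]:]"

abbreviation scale :: "complex \<Rightarrow> zpoly \<Rightarrow> zpoly" where "scale c \<equiv> smult [:c:]"

text \<open>
  The coefficient of z^a zbar^b. The indices are natural numbers: negative ones, for which the
  coefficient would be 0, are not needed.
\<close>

definition coef :: "zpoly \<Rightarrow> nat \<Rightarrow> nat \<Rightarrow> complex" where
  "coef f a b = coeff (coeff f b) a"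

definition homogeneous :: "nat \<Rightarrow> zpoly \<Rightarrow> bool" where
  "homogeneous n f \<longleftrightarrow> (\<forall>a b. coef f a b \<noteq> 0 \<longrightarrow> a + b = n)"

text \<open>\<open>subst f p q\<close> replaces (z, zbar) by (p, q).\<close>

definition subst :: "zpoly \<Rightarrow> zpoly \<Rightarrow> zpoly \<Rightarrow> zpoly" where
  "subst f p q = poly (map_poly (\<lambda>g. poly (map_poly const g) p) f) q"

definition dz :: "zpoly \<Rightarrow> zpoly" where "dz f = map_poly pderiv f"

definition dzbar :: "zpoly \<Rightarrow> zpoly" where "dzbar f = pderiv f"


subsection \<open>Dunkl operators and the intertwining operator\<close>

definition reflect :: "complex \<Rightarrow> zpoly \<Rightarrow> zpoly" where
  "reflect \<eta> f = subst f (scale \<eta> Zbar) (scale (inverse \<eta>) Z)"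

text \<open>The division is exact, see \<open>diff_quot_exact\<close> below.\<close>

definition diff_quot :: "complex \<Rightarrow> zpoly \<Rightarrow> zpoly" where
  "diff_quot \<eta> f = (f - reflect \<eta> f) div (Z - scale \<eta> Zbar)"

definition omega :: "nat \<Rightarrow> complex" where
  "omega s = exp (\<i> * of_real pi / of_nat s)"

definition T :: "nat \<Rightarrow> complex \<Rightarrow> complex \<Rightarrow> zpoly \<Rightarrow> zpoly" where
  "T s \<kappa>0 \<kappa>1 f = dz f
     + scale \<kappa>0 (\<Sum>j<s. diff_quot (omega s ^ (2*j)) f)
     + scale \<kappa>1 (\<Sum>j<s. diff_quot (omega s ^ (2*j+1)) f)"

definition Tbar :: "nat \<Rightarrow> complex \<Rightarrow> complex \<Rightarrow> zpoly \<Rightarrow> zpoly" where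
  "Tbar s \<kappa>0 \<kappa>1 f = dzbar f
     - scale \<kappa>0 (\<Sum>j<s. scale (omega s ^ (2*j)) (diff_quot (omega s ^ (2*j)) f))
     - scale \<kappa>1 (\<Sum>j<s. scale (omega s ^ (2*j+1)) (diff_quot (omega s ^ (2*j+1)) f))"

definition intertwining :: "nat \<Rightarrow> complex \<Rightarrow> complex \<Rightarrow> (zpoly \<Rightarrow> zpoly) \<Rightarrow> bool" where
  "intertwining s \<kappa>0 \<kappa>1 V \<longleftrightarrow>
     Vector_Spaces.linear scale scale V \<and>
     (\<forall>n f. homogeneous n f \<longrightarrow> homogeneous n (V f)) \<and>
     (\<forall>f. T s \<kappa>0 \<kappa>1 (V f) = V (dz f)) \<and>
     (\<forall>f. Tbar s \<kappa>0 \<kappa>1 (V f) = V (dzbar f)) \<and>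
     V 1 = 1"


subsection \<open>The polynomials \<open>f\<^sub>n\<close> and the structural constants\<close>

definition jacobi :: "nat \<Rightarrow> complex \<Rightarrow> complex \<Rightarrow> complex poly" where
  "jacobi n \<alpha> \<beta> = smult (1 / fact n)
     (\<Sum>l\<le>n. smult (pochhammer (- of_nat n) l * pochhammer (of_nat n + \<alpha> + \<beta> + 1) l
                    * pochhammer (\<alpha> + 1 + of_nat l) (n - l) / fact l)
              ([:1/2, -1/2:] ^ l))"

text \<open>
  For \<open>degree P \<le> n\<close>, \<open>homog n P\<close> is the polynomial (z zbar)^n P(x) with
  x = (z^2 + zbar^2) / (2 z zbar), the denominators being cleared term by term;
  see \<open>poly_homog\<close> below.
\<close>

definition homog :: "nat \<Rightarrow> complex poly \<Rightarrow> zpoly" where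
  "homog n P =
     (\<Sum>j\<le>n. scale (coeff P j) (scale (1/2) (Z^2 + Zbar^2) ^ j * (Z * Zbar) ^ (n - j)))"

definition f_even :: "complex \<Rightarrow> complex \<Rightarrow> nat \<Rightarrow> zpoly" where
  "f_even \<kappa>0 \<kappa>1 n =
     homog n (jacobi n (\<kappa>0 - 1/2) (\<kappa>1 - 1/2))
     + (if n = 0 then 0
        else scale (1/4) (Z^2 - Zbar^2) * homog (n - 1) (jacobi (n - 1) (\<kappa>0 + 1/2) (\<kappa>1 + 1/2)))"

definition f_odd :: "complex \<Rightarrow> complex \<Rightarrow> nat \<Rightarrow> zpoly" where
  "f_odd \<kappa>0 \<kappa>1 n =
     scale (of_nat n + \<kappa>0 + 1/2)
       (scale (1/2) (Z + Zbar) * homog n (jacobi n (\<kappa>0 - 1/2) (\<kappa>1 + 1/2)))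
     + scale (of_nat n + \<kappa>1 + 1/2)
       (scale (1/2) (Z - Zbar) * homog n (jacobi n (\<kappa>0 + 1/2) (\<kappa>1 - 1/2)))"

text \<open>
  \<open>f_even n\<close> and \<open>f_odd n\<close> are the members of degree \<open>2*n\<close> and \<open>2*n + 1\<close> of the family \<open>f_poly\<close>.
\<close>

definition f_poly :: "complex \<Rightarrow> complex \<Rightarrow> nat \<Rightarrow> zpoly" where
  "f_poly \<kappa>0 \<kappa>1 n = (if even n then f_even \<kappa>0 \<kappa>1 (n div 2) else f_odd \<kappa>0 \<kappa>1 (n div 2))"

definition lam :: "complex \<Rightarrow> complex \<Rightarrow> nat \<Rightarrow> complex" where
  "lam \<kappa>0 \<kappa>1 m =
     (let n = m div 2; n' = (if even m then n else n + 1)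
      in fact n * pochhammer (\<kappa>0 + \<kappa>1 + 1) n
         / (pochhammer (\<kappa>0 + 1/2) n' * pochhammer (\<kappa>1 + 1/2) n'))"


subsection \<open>Consistency of the encoding\<close>

lemma subst_pCons: "subst (pCons g f) p q = poly (map_poly const g) p + q * subst f p q"
  by (simp add: subst_def map_poly_pCons)

lemma reflect_diagonal:
  assumes "\<eta> \<noteq> 0"
  shows "poly (reflect \<eta> f) [:0, inverse \<eta>:] = poly f [:0, inverse \<eta>:]"
proof -
  let ?w = "[:0, inverse \<eta>:]"
  have inner: "poly (poly (map_poly const g) (scale \<eta> Zbar)) ?w = g" for g
    using assms by (induction g) (simp_all add: map_poly_pCons Zbar_def)
  have zero: "subst 0 p q = 0" for p q
    by (simp add: subst_def)
  show ?thesis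
    unfolding reflect_def
    by (induction f) (simp_all add: subst_pCons inner zero Z_def)
qed

lemma diff_quot_exact:
  assumes "\<eta> \<noteq> 0"
  shows "diff_quot \<eta> f * (Z - scale \<eta> Zbar) = f - reflect \<eta> f"
proof -
  let ?w = "[:0, inverse \<eta>:]"
  have "poly (f - reflect \<eta> f) ?w = 0"
    using reflect_diagonal[OF assms] by simp
  then have dvd: "[:- ?w, 1:] dvd f - reflect \<eta> f"
    by (rule poly_eq_0_iff_dvd[THEN iffD1])
  have "[:- ?w, 1:] = (Z - scale \<eta> Zbar) * const (- inverse \<eta>)"
    using assms by (simp add: Z_def Zbar_def)
  then have "Z - scale \<eta> Zbar dvd [:- ?w, 1:]"
    by (metis dvd_triv_left)
  then show ?thesis
    unfolding diff_quot_def using dvd by (intro dvd_div_mult_self) (rule dvd_trans)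
qed

lemma degree_jacobi: "degree (jacobi n \<alpha> \<beta>) \<le> n"
proof -
  have "degree ([:1/2, -1/2:] ^ l :: complex poly) \<le> n" if "l \<le> n" for l
    using that degree_power_le[of "[:1/2, -1/2:] :: complex poly" l] by simp
  then show ?thesis
    unfolding jacobi_def
    by (intro order.trans[OF degree_smult_le] degree_sum_le) (auto intro: order.trans[OF degree_smult_le])
qed

lemma poly_homog:
  assumes "degree P \<le> n" and "x \<noteq> 0" and "y \<noteq> 0"
  shows "poly (poly (homog n P) [:y:]) x = (x * y) ^ n * poly P ((x^2 + y^2) / (2 * x * y))"
proof -
  have "poly (poly (homog n P) [:y:]) x
      = (\<Sum>j\<le>n. coeff P j * (((x^2 + y^2) / 2) ^ j * (x * y) ^ (n - j)))"
    by (simp add: homog_def poly_sum poly_power Z_def Zbar_def algebra_simps add_divide_distrib)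
  also have "\<dots> = (\<Sum>j\<le>n. (x * y) ^ n * (coeff P j * ((x^2 + y^2) / (2 * x * y)) ^ j))"
  proof (intro sum.cong refl)
    fix j assume "j \<in> {..n}"
    then have "(x * y) ^ n = (x * y) ^ (n - j) * (x * y) ^ j"
      by (simp flip: power_add)
    moreover have "((x^2 + y^2) / 2) ^ j = (x * y) ^ j * ((x^2 + y^2) / (2 * x * y)) ^ j"
      using assms by (simp flip: power_mult_distrib)
    ultimately show "coeff P j * (((x^2 + y^2) / 2) ^ j * (x * y) ^ (n - j))
        = (x * y) ^ n * (coeff P j * ((x^2 + y^2) / (2 * x * y)) ^ j)"
      by simp
  qed
  also have "\<dots> = (x * y) ^ n * poly P ((x^2 + y^2) / (2 * x * y))"
    unfolding poly_altdef sum_distrib_left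
    using assms(1) by (intro sum.mono_neutral_right) (auto simp: coeff_eq_0)
  finally show ?thesis .
qed

end

theory Submission
  imports Defs
begin

text \<open>
  Write \<open>x = z^s\<close>, \<open>y = zbar^s\<close>, \<open>F n = f_n(z^s)\<close> and let \<open>*\<close> exchange \<open>z\<close> and \<open>zbar\<close>.
  Contiguous relations of Jacobi polynomials amount to a recursion
  \<open>F (n+1) = A x F n + B y (F n)*\<close> with scalars satisfying
  \<open>B (n+1+\<kappa>0+\<kappa>1) = A (\<kappa>0-(-1)^n \<kappa>1)\<close> and \<open>\<lambda>_(n+1) (A^2 - B^2) = \<lambda>_n\<close>. The first
  identity gives, by induction, \<open>Tbar (z^t F n) = 0\<close> for \<open>t < s\<close> and
  \<open>T (z^t F n) = (ns + t + \<gamma>) z^(t-1) F n\<close> for \<open>1 \<le> t \<le> s\<close>, where \<open>\<gamma> = s (\<kappa>0 + \<kappa>1)\<close>; the second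
  one makes the reproducing kernel of the h-harmonic polynomials of degree \<open>N\<close> symmetric
  under \<open>*\<close>, also when \<open>s\<close> divides \<open>N\<close> (a case that the theorem leaves out but that the
  induction on the degree passes through). Hence the candidates \<open>w a b\<close> for
  \<open>V (z^a zbar^b) / (a! b!)\<close> satisfy \<open>T (w a b) = w (a-1) b\<close> and \<open>Tbar (w a b) = w a (b-1)\<close>. The
  mere existence of \<open>V\<close> shows that no nonzero homogeneous polynomial of positive degree is killed
  by both \<open>T\<close> and \<open>Tbar\<close>, so the two agree.
\<close>

subsection \<open>Polynomials in \<open>z\<close> and \<open>zbar\<close>\<close>

text \<open>Constants, \<open>Z\<close> and \<open>Zbar\<close> generate C[z][zbar] as a ring, so
  that identities between ring homomorphisms or derivations need checking only on these generators,
  without a nested induction over coefficients.\<close>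

lemma zpoly_induct [case_names const add Z Zbar]:
  assumes "\<And>c. P (const c)" and "\<And>f g. P f \<Longrightarrow> P g \<Longrightarrow> P (f + g)"
    and "\<And>f. P f \<Longrightarrow> P (Z * f)" and "\<And>f. P f \<Longrightarrow> P (Zbar * f)"
  shows "P f"
proof (induction f)
  case 0
  show ?case using assms(1)[of 0] by simp
next
  case (pCons g f)
  have "P [:g:]"
  proof (induction g)
    case 0
    show ?case using assms(1)[of 0] by simp
  next
    case (pCons c g)
    have "[:pCons c g:] = const c + Z * [:g:]" by (simp add: Z_def)
    then show ?case using pCons assms by metis
  qed
  moreover have "pCons g f = [:g:] + Zbar * f" by (simp add: Zbar_def)
  ultimately show ?case using pCons assms by metis
qed

lemma scale_1 [simp]: "scale 1 f = f"
  by (simp flip: one_pCons)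

lemma scale_eq: "scale c f = const c * f" by simp

lemma const_add: "const (a + b) = const a + const b" by simp
lemma const_mult: "const (a * b) = const a * const b" by simp
lemma const_diff: "const (a - b) = const a - const b" by simp
lemma const_of_nat: "const (of_nat n) = of_nat n" by (simp add: of_nat_poly)

section \<open>Substitution as a ring homomorphism\<close>

lemma subst_0 [simp]: "subst 0 p q = 0"
  by (simp add: subst_def)

lemma map_poly_const_add: "map_poly const (g + h) = map_poly const g + map_poly const h"
  by (intro poly_eqI) (simp add: coeff_map_poly)

lemma map_poly_const_smult: "map_poly const (smult c g) = smult (const c) (map_poly const g)"
  by (intro poly_eqI) (simp add: coeff_map_poly)

lemma map_poly_const_mult: "map_poly const (g * h) = map_poly const g * map_poly const h"
  by (induction g) (simp_all add: map_poly_const_add map_poly_const_smult map_poly_pCons)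

lemma subst_add [simp]: "subst (f + g) p q = subst f p q + subst g p q"
  by (induction f g rule: poly_induct2)
    (simp_all add: subst_pCons map_poly_const_add algebra_simps)

lemma subst_smult: "subst (smult g f) p q = poly (map_poly const g) p * subst f p q"
  by (induction f) (simp_all add: subst_pCons map_poly_const_mult algebra_simps)

lemma subst_mult [simp]: "subst (f * g) p q = subst f p q * subst g p q"
  by (induction f) (simp_all add: subst_pCons subst_smult algebra_simps)

lemma subst_const [simp]: "subst (const c) p q = const c"
  by (simp add: subst_pCons map_poly_pCons)

lemma subst_scale [simp]: "subst (scale c f) p q = scale c (subst f p q)"
  by (simp add: subst_smult map_poly_pCons)

lemma subst_1 [simp]: "subst 1 p q = 1"
  using subst_const[of 1] by (simp add: one_pCons)

lemma subst_Z [simp]: "subst Z p q = p"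
  by (simp add: Z_def subst_pCons map_poly_pCons)

lemma subst_Zbar [simp]: "subst Zbar p q = q"
  by (simp add: Zbar_def subst_pCons one_pCons map_poly_pCons)

lemma subst_power [simp]: "subst (f ^ n) p q = subst f p q ^ n"
  by (induction n) simp_all

lemma subst_minus [simp]: "subst (- f) p q = - subst f p q"
  by (metis subst_add subst_0 add.right_inverse add_eq_0_iff)

lemma subst_diff [simp]: "subst (f - g) p q = subst f p q - subst g p q"
  using subst_add[of f "- g"] by simp

lemma subst_sum [simp]: "subst (sum f A) p q = (\<Sum>x\<in>A. subst (f x) p q)"
  by (induction A rule: infinite_finite_induct) simp_all

lemma subst_subst: "subst (subst f p q) p' q' = subst f (subst p p' q') (subst q p' q')"
  by (induction f rule: zpoly_induct) (simp_all del: mult_pCons_left)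

text \<open>The operation \<open>*\<close> of the overview; it is the reflection with \<eta> = 1.
  Conjugation by it exchanges \<open>T\<close> and \<open>Tbar\<close>, so that each fact about one
  operator yields a fact about the other.\<close>

definition swap :: "zpoly \<Rightarrow> zpoly" where "swap f = subst f Zbar Z"

lemma swap_simps [simp]:
  "swap Z = Zbar" "swap Zbar = Z" "swap (f + g) = swap f + swap g" "swap (f - g) = swap f - swap g"
  "swap (f * g) = swap f * swap g" "swap (f ^ n) = swap f ^ n" "swap (- f) = - swap f"
  "swap (scale c f) = scale c (swap f)" "swap (const c) = const c" "swap 0 = 0" "swap 1 = 1"
  "swap (sum h A) = (\<Sum>x\<in>A. swap (h x))"
  by (simp_all add: swap_def del: mult_pCons_left)

lemma swap_swap [simp]: "swap (swap f) = f"
  by (induction f rule: zpoly_induct) (simp_all del: mult_pCons_left)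

lemma swap_of_nat [simp]: "swap (of_nat n) = of_nat n"
  by (metis const_of_nat swap_simps(9))

lemma reflect_simps [simp]:
  "reflect \<eta> Z = scale \<eta> Zbar" "reflect \<eta> Zbar = scale (inverse \<eta>) Z"
  "reflect \<eta> (f + g) = reflect \<eta> f + reflect \<eta> g" "reflect \<eta> (f - g) = reflect \<eta> f - reflect \<eta> g"
  "reflect \<eta> (f * g) = reflect \<eta> f * reflect \<eta> g" "reflect \<eta> (f ^ n) = reflect \<eta> f ^ n"
  "reflect \<eta> (scale c f) = scale c (reflect \<eta> f)" "reflect \<eta> (const c) = const c"
  "reflect \<eta> 0 = 0" "reflect \<eta> 1 = 1"
  by (simp_all add: reflect_def del: mult_pCons_left)

lemma swap_reflect:
  assumes "\<eta> \<noteq> 0"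
  shows "swap (reflect \<eta> f) = reflect (inverse \<eta>) (swap f)"
  by (induction f rule: zpoly_induct) (simp_all del: mult_pCons_left)

section \<open>Partial derivatives\<close>

lemma dz_simps [simp]:
  "dz (f + g) = dz f + dz g" "dz (scale c f) = scale c (dz f)" "dz 0 = 0" "dz (const c) = 0"
  "dz 1 = 0" "dz Z = 1" "dz Zbar = 0" "dz (f - g) = dz f - dz g"
  by (auto simp: dz_def Z_def Zbar_def map_poly_pCons coeff_map_poly pderiv_pCons pderiv_add
      pderiv_diff pderiv_smult one_pCons intro!: poly_eqI)

lemma dz_mult: "dz (f * g) = dz f * g + f * dz g"
  by (intro poly_eqI, simp add: dz_def coeff_map_poly coeff_mult)
    (simp add: higher_pderiv_sum[of 1, simplified] pderiv_mult sum.distrib algebra_simps)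

lemma dzbar_simps [simp]:
  "dzbar (f + g) = dzbar f + dzbar g" "dzbar (scale c f) = scale c (dzbar f)" "dzbar 0 = 0"
  "dzbar (const c) = 0" "dzbar 1 = 0" "dzbar Z = 0" "dzbar Zbar = 1" "dzbar (f - g) = dzbar f - dzbar g"
  by (simp_all add: dzbar_def Z_def Zbar_def pderiv_pCons pderiv_add pderiv_diff pderiv_smult one_pCons)

lemma dzbar_mult: "dzbar (f * g) = dzbar f * g + f * dzbar g"
  by (simp add: dzbar_def pderiv_mult algebra_simps)

lemma swap_dz: "swap (dz f) = dzbar (swap f)"
  by (induction f rule: zpoly_induct) (simp_all add: dz_mult dzbar_mult del: mult_pCons_left)

text \<open>Multiplied by \<open>Z\<close>, the power rule involves no exponent n - 1; the factor is
  cancelled at the end of a computation.\<close>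

lemma dz_Z_power: "Z * dz (Z ^ n) = of_nat n * Z ^ n"
  by (induction n) (simp_all add: dz_mult algebra_simps)
lemma dz_Zbar_power [simp]: "dz (Zbar ^ n) = 0"
  by (induction n) (simp_all add: dz_mult)
lemma dzbar_Z_power [simp]: "dzbar (Z ^ n) = 0"
  by (induction n) (simp_all add: dzbar_mult)
lemma dzbar_Zbar_power: "Zbar * dzbar (Zbar ^ n) = of_nat n * Zbar ^ n"
  by (induction n) (simp_all add: dzbar_mult algebra_simps)

lemma Z_nonzero [simp]: "Z \<noteq> 0" and Zbar_nonzero [simp]: "Zbar \<noteq> 0"
  by (simp_all add: Z_def Zbar_def)

section \<open>Coefficients of monomials\<close>

lemma coef_add [simp]: "coef (f + g) a b = coef f a b + coef g a b"
  and coef_scale [simp]: "coef (scale c f) a b = c * coef f a b"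
  and coef_0 [simp]: "coef 0 a b = 0"
  and coef_diff [simp]: "coef (f - g) a b = coef f a b - coef g a b"
  and coef_const: "coef (const c) a b = (if a = 0 \<and> b = 0 then c else 0)"
  by (auto simp: coef_def coeff_pCons split: nat.splits)

lemma coef_sum [simp]: "coef (sum h A) a b = (\<Sum>x\<in>A. coef (h x) a b)"
  by (induction A rule: infinite_finite_induct) simp_all

lemma coef_Z_mult: "coef (Z * f) a b = (if a = 0 then 0 else coef f (a - 1) b)"
  by (simp add: coef_def Z_def coeff_pCons split: nat.splits)

lemma coef_Zbar_mult: "coef (Zbar * f) a b = (if b = 0 then 0 else coef f a (b - 1))"
  by (simp add: coef_def Zbar_def coeff_pCons split: nat.splits)

lemma coef_Z_power_mult: "coef (Z ^ n * f) a b = (if a < n then 0 else coef f (a - n) b)"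
  by (induction n arbitrary: a) (auto simp: coef_Z_mult mult.assoc)

lemma coef_Zbar_power_mult: "coef (Zbar ^ n * f) a b = (if b < n then 0 else coef f a (b - n))"
  by (induction n arbitrary: b) (auto simp: coef_Zbar_mult mult.assoc)

lemma coef_swap: "coef (swap f) a b = coef f b a"
  by (induction f arbitrary: a b rule: zpoly_induct)
    (simp_all add: coef_const coef_Z_mult coef_Zbar_mult del: mult_pCons_left)

lemma zpoly_eqI: "(\<And>a b. coef f a b = coef g a b) \<Longrightarrow> f = g"
  by (intro poly_eqI) (simp add: coef_def)

lemma coef_subst_powers:
  assumes "s > 0"
  shows "coef (subst f (Z ^ s) (Zbar ^ s)) a b
    = (if s dvd a \<and> s dvd b then coef f (a div s) (b div s) else 0)"
proof (induction f arbitrary: a b rule: zpoly_induct)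
  case (Z f)
  have "a < s \<Longrightarrow> s dvd a \<Longrightarrow> a div s = 0" "a \<ge> s \<Longrightarrow> s dvd (a - s) \<longleftrightarrow> s dvd a"
    "a \<ge> s \<Longrightarrow> (a - s) div s = a div s - 1" "a \<ge> s \<Longrightarrow> a div s \<noteq> 0"
    using assms by (auto simp: dvd_minus_self le_div_geq)
  then show ?case using Z by (auto simp: coef_Z_mult coef_Z_power_mult)
next
  case (Zbar f)
  have "b < s \<Longrightarrow> s dvd b \<Longrightarrow> b div s = 0" "b \<ge> s \<Longrightarrow> s dvd (b - s) \<longleftrightarrow> s dvd b"
    "b \<ge> s \<Longrightarrow> (b - s) div s = b div s - 1" "b \<ge> s \<Longrightarrow> b div s \<noteq> 0"
    using assms by (auto simp: dvd_minus_self le_div_geq)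
  then show ?case using Zbar by (auto simp: coef_Zbar_mult coef_Zbar_power_mult)
qed (use assms in \<open>auto simp: coef_const\<close>)

section \<open>Homogeneous polynomials\<close>

lemma homogeneous_add: "homogeneous n f \<Longrightarrow> homogeneous n g \<Longrightarrow> homogeneous n (f + g)"
  by (auto simp: homogeneous_def) (metis add.right_neutral)

lemma homogeneous_scale: "homogeneous n f \<Longrightarrow> homogeneous n (scale c f)"
  by (simp add: homogeneous_def)

lemma homogeneous_0: "homogeneous n 0"
  by (simp add: homogeneous_def)

lemma homogeneous_1: "homogeneous 0 1"
  using coef_const[of 1] by (simp add: homogeneous_def one_pCons split: if_splits)

lemma homogeneous_sum: "(\<And>x. x \<in> A \<Longrightarrow> homogeneous n (h x)) \<Longrightarrow> homogeneous n (sum h A)"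
  by (induction A rule: infinite_finite_induct) (simp_all add: homogeneous_0 homogeneous_add)

lemma homogeneous_Z_power:
  assumes "homogeneous n f"
  shows "homogeneous (k + n) (Z ^ k * f)"
  unfolding homogeneous_def
proof (intro allI impI)
  fix a b assume "coef (Z ^ k * f) a b \<noteq> 0"
  then have "k \<le> a" "coef f (a - k) b \<noteq> 0"
    by (auto simp: coef_Z_power_mult split: if_splits)
  with assms have "a - k + b = n" by (auto simp: homogeneous_def)
  with \<open>k \<le> a\<close> show "a + b = k + n" by simp
qed

lemma homogeneous_swap: "homogeneous n f \<Longrightarrow> homogeneous n (swap f)"
  unfolding homogeneous_def coef_swap by (metis add.commute)

lemma homogeneous_Zbar_power:
  assumes "homogeneous n f"
  shows "homogeneous (k + n) (Zbar ^ k * f)"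
  using homogeneous_swap[OF homogeneous_Z_power[OF homogeneous_swap[OF assms]], of k] by simp

lemma coef_monomial: "coef (Z ^ i * Zbar ^ j) a b = (if a = i \<and> b = j then 1 else 0)"
  using coef_const[of 1 "a - i" "b - j"] coef_Zbar_power_mult[of j 1 "a - i" b]
  by (auto simp: coef_Z_power_mult one_pCons)

lemma homogeneous_expand:
  assumes "homogeneous n f"
  shows "f = (\<Sum>a\<le>n. scale (coef f a (n - a)) (Z ^ a * Zbar ^ (n - a)))"
proof (rule zpoly_eqI)
  fix a b
  have "coef (\<Sum>a\<le>n. scale (coef f a (n - a)) (Z ^ a * Zbar ^ (n - a))) a b
      = (\<Sum>i\<le>n. if a = i \<and> b = n - i then coef f i (n - i) else 0)"
    by (subst coef_sum, subst coef_scale, intro sum.cong) (auto simp: coef_monomial)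
  also have "\<dots> = (\<Sum>i\<le>n. if i = a then (if b = n - a then coef f a (n - a) else 0) else 0)"
    by (intro sum.cong) auto
  also have "\<dots> = coef f a b"
  proof (cases "coef f a b = 0")
    case False
    then have "a + b = n" using assms by (auto simp: homogeneous_def)
    then show ?thesis by auto
  qed auto
  finally show "coef f a b = coef (\<Sum>a\<le>n. scale (coef f a (n - a)) (Z ^ a * Zbar ^ (n - a))) a b"
    by (rule sym)
qed

subsection \<open>Uniqueness of the intertwining operator\<close>

lemma coef_dz: "coef (dz f) a b = of_nat (Suc a) * coef f (Suc a) b"
  by (simp add: coef_def dz_def coeff_map_poly coeff_pderiv)

lemma coef_dzbar: "coef (dzbar f) a b = of_nat (Suc b) * coef f a (Suc b)"
  by (simp add: coef_def dzbar_def coeff_pderiv of_nat_poly del: of_nat_Suc)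

lemma homogeneous_dz:
  assumes "homogeneous n f"
  shows "homogeneous (n - 1) (dz f)"
  using assms unfolding homogeneous_def coef_dz by fastforce

lemma homogeneous_dzbar:
  assumes "homogeneous n f"
  shows "homogeneous (n - 1) (dzbar f)"
  using assms unfolding homogeneous_def coef_dzbar by fastforce

text \<open>Every coefficient other than the constant one occurs, up to a positive integer factor,
  in \<open>dz f\<close> or \<open>dzbar f\<close>, and positive degree excludes a constant
  term.\<close>

lemma homogeneous_eq_0_if_derivs_0:
  assumes "homogeneous n f" "n \<ge> 1" "dz f = 0" "dzbar f = 0"
  shows "f = 0"
proof (rule zpoly_eqI)
  fix a b
  have "coef f (Suc i) j = 0" "coef f i (Suc j) = 0" for i j
    using coef_dz[of f i j] coef_dzbar[of f i j] assms
    by (simp_all del: of_nat_Suc)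
  moreover have "coef f 0 0 = 0"
    using assms(1,2) unfolding homogeneous_def by fastforce
  ultimately have "coef f a b = 0" by (metis not0_implies_Suc)
  then show "coef f a b = coef 0 a b" by simp
qed

lemma homogeneous_monomial: "homogeneous (a + b) (Z ^ a * Zbar ^ b)"
  using homogeneous_Z_power[OF homogeneous_Zbar_power[OF homogeneous_1]] by simp

lemma diff_quot_0 [simp]: "diff_quot \<eta> 0 = 0"
  by (simp add: diff_quot_def)

lemma T_0 [simp]: "T s \<kappa>0 \<kappa>1 0 = 0" and Tbar_0 [simp]: "Tbar s \<kappa>0 \<kappa>1 0 = 0"
  by (simp_all add: T_def Tbar_def)

text \<open>Induction on the degree: if V f = 0, then V (dz f) = T (V f) = 0 and likewise for
  \<open>dzbar\<close>, so both derivatives vanish by the induction hypothesis. Degree 0 rests on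
  the normalization V 1 = 1.\<close>

lemma intertwining_injective:
  assumes V: "intertwining s \<kappa>0 \<kappa>1 V"
  shows "homogeneous n f \<Longrightarrow> V f = 0 \<Longrightarrow> f = 0"
proof (induction n arbitrary: f)
  case 0
  interpret V: Vector_Spaces.linear scale scale V
    using V by (simp add: intertwining_def)
  have "V 1 = 1"
    using V by (simp add: intertwining_def)
  moreover have "f = scale (coef f 0 0) 1"
    using homogeneous_expand[OF 0(1)] by simp
  ultimately have "scale (coef f 0 0) 1 = 0"
    using 0(2) by (metis V.scale)
  with \<open>f = _\<close> show ?case by simp
next
  case (Suc n)
  have "V (dz f) = 0" "V (dzbar f) = 0"
    using V Suc.prems T_0 Tbar_0 unfolding intertwining_def by metis+
  then have "dz f = 0" "dzbar f = 0"
    using Suc homogeneous_dz[OF Suc.prems(1)] homogeneous_dzbar[OF Suc.prems(1)] by auto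
  then show ?case
    using homogeneous_eq_0_if_derivs_0[OF Suc.prems(1)] by simp
qed

text \<open>\<open>V\<close> is injective on the finite-dimensional space of homogeneous polynomials of degree
  \<open>n\<close>, hence onto, and therefore transports the triviality of the common kernel from the partial
  derivatives to the Dunkl operators.\<close>

lemma intertwining_surjective:
  assumes V: "intertwining s \<kappa>0 \<kappa>1 V" and f: "homogeneous n f"
  shows "\<exists>g. homogeneous n g \<and> V g = f"
proof -
  interpret V: Vector_Spaces.linear scale scale V
    using V by (simp add: intertwining_def)
  let ?m = "\<lambda>a. Z ^ a * Zbar ^ (n - a)"
  define M where "M = ?m ` {..n}"
  have fin: "finite M" and card: "card M \<le> Suc n"
    using card_image_le[of "{..n}" ?m] by (simp_all add: M_def)
  have hom_span: "h \<in> V.vs1.span M" if "homogeneous n h" for h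
  proof -
    have "(\<Sum>a\<le>n. scale (coef h a (n - a)) (?m a)) \<in> V.vs1.span M"
      by (intro V.vs1.span_sum V.vs1.span_scale V.vs1.span_base) (simp add: M_def)
    then show ?thesis using homogeneous_expand[OF that] by simp
  qed
  have span_hom: "homogeneous n h" if "h \<in> V.vs1.span M" for h
    using that
  proof (induction rule: V.vs1.span_induct_alt)
    case (step c x y)
    then have "homogeneous n x"
      using homogeneous_monomial[of _ "n - _"] by (auto simp: M_def) (metis le_add_diff_inverse)
    then show ?case using step by (intro homogeneous_add homogeneous_scale)
  qed (rule homogeneous_0)
  have coef0: "c a = 0" if "(\<Sum>a\<le>n. scale (c a) (?m a)) = 0" "a \<le> n" for c a
  proof -
    have "0 = coef (\<Sum>a\<le>n. scale (c a) (?m a)) a (n - a)" using that by simp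
    also have "\<dots> = (\<Sum>i\<le>n. if i = a then c a else 0)"
      by (subst coef_sum, subst coef_scale, intro sum.cong) (auto simp: coef_monomial)
    finally show ?thesis using that by simp
  qed
  have inj: "inj_on ?m {..n}"
    by (intro inj_onI) (metis coef_monomial zero_neq_one)
  have indep: "V.vs1.independent M"
  proof (rule V.vs1.independent_if_scalars_zero[OF fin])
    fix c x assume "(\<Sum>x\<in>M. scale (c x) x) = 0" "x \<in> M"
    then have "(\<Sum>a\<le>n. scale (c (?m a)) (?m a)) = 0"
      using sum.reindex[OF inj, of "\<lambda>x. scale (c x) x"] by (simp add: M_def)
    from coef0[OF this] \<open>x \<in> M\<close> show "c x = 0" by (auto simp: M_def)
  qed
  have V_inj: "inj_on V (V.vs1.span M)"
  proof (rule inj_onI)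
    fix g h assume "g \<in> V.vs1.span M" "h \<in> V.vs1.span M" "V g = V h"
    then have "homogeneous n (g - h)" "V (g - h) = 0"
      by (simp_all add: span_hom V.vs1.span_diff V.diff)
    then show "g = h" using intertwining_injective[OF V] by fastforce
  qed
  have indepV: "V.vs1.independent (V ` M)"
    using V.independent_injective_image[OF indep V_inj] .
  have cardV: "card (V ` M) = Suc n" 
    using inj_on_subset[OF V_inj V.vs1.span_superset] inj by (simp add: card_image M_def)
  have "f \<in> V.vs1.span (V ` M)"
  \<comment> \<open>Otherwise f together with the n + 1 images of the monomials would form n + 2
    independent elements of a space spanned by n + 1 monomials.\<close>
  proof (rule ccontr)
    assume f': "f \<notin> V.vs1.span (V ` M)"
    then have "V.vs1.independent (insert f (V ` M))"
      using indepV by (rule V.vs1.independent_insertI)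
    moreover have "insert f (V ` M) \<subseteq> V.vs1.span M"
    proof -
      have "V m \<in> V.vs1.span M" if "m \<in> M" for m
        using that V hom_span span_hom V.vs1.span_base unfolding intertwining_def by blast
      then show ?thesis using hom_span[OF f] by auto
    qed
    ultimately have "card (insert f (V ` M)) \<le> card M"
      using V.vs1.independent_span_bound[OF fin] by blast
    moreover have "f \<notin> V ` M" using f' V.vs1.span_base by blast
    ultimately show False using fin card cardV by simp
  qed
  then have "f \<in> V ` V.vs1.span M" by (simp add: V.span_image)
  then show ?thesis using span_hom by blast
qed

lemma intertwining_kernel:
  assumes V: "intertwining s \<kappa>0 \<kappa>1 V" and f: "homogeneous n f" "n \<ge> 1"
    and "T s \<kappa>0 \<kappa>1 f = 0" "Tbar s \<kappa>0 \<kappa>1 f = 0"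
  shows "f = 0"
proof -
  obtain g where g: "homogeneous n g" "V g = f"
    using intertwining_surjective[OF V f(1)] by blast
  then have "V (dz g) = 0" "V (dzbar g) = 0"
    using assms unfolding intertwining_def by metis+
  then have "dz g = 0" "dzbar g = 0"
    using intertwining_injective[OF V] homogeneous_dz[OF g(1)] homogeneous_dzbar[OF g(1)] by blast+
  then have "g = 0" using homogeneous_eq_0_if_derivs_0 g f by blast
  interpret V: Vector_Spaces.linear scale scale V
    using V by (simp add: intertwining_def)
  from \<open>g = 0\<close> show ?thesis
    using g V.zero by simp
qed

subsection \<open>Contiguous relations of Jacobi polynomials\<close>

text \<open>The coefficient of ((1 - x)/2)^l in the Jacobi polynomial, with (-n)_l / n! rewritten as
  (-1)^l / (n - l)!. Its value 0 for l > n allows polynomials of neighbouring degrees to be compared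
  over a common range of summation.\<close>

definition jacobi_coeff :: "nat \<Rightarrow> complex \<Rightarrow> complex \<Rightarrow> nat \<Rightarrow> complex" where
  "jacobi_coeff n \<alpha> \<beta> l = (if l \<le> n then (- 1) ^ l * pochhammer (of_nat n + \<alpha> + \<beta> + 1) l
      * pochhammer (\<alpha> + 1 + of_nat l) (n - l) / (fact l * fact (n - l)) else 0)"

definition half_diff :: "complex poly" where "half_diff = [:1/2, -1/2:]"

lemma smult_sum_right: "smult c (sum h A) = (\<Sum>x\<in>A. smult c (h x))"
  by (induction A rule: infinite_finite_induct) (simp_all add: smult_add_right)

lemma pochhammer_minus_of_nat:
  assumes "l \<le> n"
  shows "pochhammer (- of_nat n :: complex) l * fact (n - l) = (- 1) ^ l * fact n"
  using assms
proof (induction l)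
  case (Suc l)
  then have "(fact (n - l) :: complex) = of_nat (n - l) * fact (n - Suc l)"
    by (metis Suc_diff_Suc Suc_le_lessD fact_Suc of_nat_fact of_nat_mult)
  with Suc have *: "pochhammer (- of_nat n :: complex) l * (of_nat (n - l) * fact (n - Suc l))
      = (- 1) ^ l * fact n" by simp
  have "pochhammer (- of_nat n :: complex) (Suc l) * fact (n - Suc l)
      = - (pochhammer (- of_nat n :: complex) l * (of_nat (n - l) * fact (n - Suc l)))"
    using Suc.prems by (simp add: pochhammer_Suc of_nat_diff algebra_simps)
  also have "\<dots> = (- 1) ^ Suc l * fact n" unfolding * by simp
  finally show ?case .
qed simp

lemma jacobi_eq_sum: 
  assumes "n \<le> N"
  shows "jacobi n \<alpha> \<beta> = (\<Sum>l\<le>N. smult (jacobi_coeff n \<alpha> \<beta> l) (half_diff ^ l))"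
proof -
  have "jacobi n \<alpha> \<beta> = (\<Sum>l\<le>n. smult (jacobi_coeff n \<alpha> \<beta> l) (half_diff ^ l))"
    unfolding jacobi_def smult_sum_right smult_smult half_diff_def
  proof (intro sum.cong arg_cong2[where f = smult] refl)
    fix l assume "l \<in> {..n}"
    then have "pochhammer (- of_nat n :: complex) l = (- 1) ^ l * fact n / fact (n - l)"
      using pochhammer_minus_of_nat[of l n] by (simp add: field_simps)
    then show "1 / fact n * (pochhammer (- of_nat n) l * pochhammer (of_nat n + \<alpha> + \<beta> + 1) l *
        pochhammer (\<alpha> + 1 + of_nat l) (n - l) / fact l) = jacobi_coeff n \<alpha> \<beta> l"
      using \<open>l \<in> _\<close> by (simp add: jacobi_coeff_def mult_ac)
  qed
  also have "\<dots> = (\<Sum>l\<le>N. smult (jacobi_coeff n \<alpha> \<beta> l) (half_diff ^ l))"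
    using assms by (intro sum.mono_neutral_left) (auto simp: jacobi_coeff_def)
  finally show ?thesis .
qed

lemma half_diff_times_jacobi:
  "half_diff * jacobi n \<alpha> \<beta>
    = (\<Sum>l\<le>Suc n. smult (if l = 0 then 0 else jacobi_coeff n \<alpha> \<beta> (l - 1)) (half_diff ^ l))"
  by (subst sum.atMost_Suc_shift)
    (simp add: jacobi_eq_sum[of n n] sum_distrib_left)

lemma inverse_fact_eq: "inverse (fact k) = (of_nat k + 1) * (inverse (fact (Suc k)) :: complex)"
  by (simp add: field_simps del: of_nat_Suc) (simp add: algebra_simps)

lemma jacobi_coeff_eq: "l \<le> n \<Longrightarrow> jacobi_coeff n \<alpha> \<beta> l = (- 1) ^ l * pochhammer (of_nat n + \<alpha> + \<beta> + 1) l
      * pochhammer (\<alpha> + 1 + of_nat l) (n - l) * inverse (fact l) * inverse (fact (n - l))"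
  by (simp add: jacobi_coeff_def field_simps)

text \<open>For l = k + 1 the three terms share the factor (-1)^l \<open>R * X\<close>, once 1/k! is
  written as (k + 1)/l!; what remains is c + (k + 1) = c + 1 + k.\<close>

lemma jacobi_coeff_contiguous1:
  "jacobi_coeff (Suc m) \<alpha> \<beta> l - (if l = 0 then 0 else jacobi_coeff m (\<alpha> + 1) (\<beta> + 1) (l - 1)) = jacobi_coeff (Suc m) \<alpha> (\<beta> + 1) l"
proof (cases l)
  case (Suc k)
  show ?thesis
  proof (cases "k \<le> m")
    case True
    define c where "c = of_nat m + \<alpha> + \<beta> + 2"
    define X where "X = pochhammer (\<alpha> + 1 + of_nat l) (m - k) * inverse (fact l) * inverse (fact (m - k))"
    define R where "R = pochhammer (c + 1) k"
    have 1: "pochhammer c (Suc k) = c * R" "pochhammer (c + 1) (Suc k) = (c + 1 + of_nat k) * R"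
      unfolding R_def by (rule pochhammer_rec pochhammer_rec')+
    have 2: "of_nat m + (\<alpha> + 1) + (\<beta> + 1) + 1 = c + 1" "of_nat (Suc m) + \<alpha> + \<beta> + 1 = c"
      "of_nat (Suc m) + \<alpha> + (\<beta> + 1) + 1 = c + 1" "\<alpha> + 1 + 1 + of_nat k = \<alpha> + 1 + of_nat l"
      by (simp_all add: c_def Suc)
    have j1: "jacobi_coeff (Suc m) \<alpha> \<beta> l = (- 1) ^ l * c * R * X"
      using True by (subst jacobi_coeff_eq) (simp_all only: 2 1 X_def Suc diff_Suc_Suc Suc_le_mono mult_ac)
    have j2: "jacobi_coeff (Suc m) \<alpha> (\<beta> + 1) l = (- 1) ^ l * (c + 1 + of_nat k) * R * X"
      using True by (subst jacobi_coeff_eq) (simp_all only: 2 1 X_def Suc diff_Suc_Suc Suc_le_mono mult_ac)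
    have j3: "jacobi_coeff m (\<alpha> + 1) (\<beta> + 1) k = (- 1) ^ k * R * X * (of_nat k + 1)"
      using True by (subst jacobi_coeff_eq)
        (simp_all only: 2 1 X_def R_def Suc diff_Suc_Suc Suc_le_mono mult_ac inverse_fact_eq[of k])
    have "jacobi_coeff (Suc m) \<alpha> \<beta> l - jacobi_coeff m (\<alpha> + 1) (\<beta> + 1) k = jacobi_coeff (Suc m) \<alpha> (\<beta> + 1) l"
      unfolding j1 j2 j3 by (simp add: Suc algebra_simps)
    then show ?thesis by (simp add: Suc)
  qed (use Suc in \<open>simp add: jacobi_coeff_def\<close>)
qed (simp add: jacobi_coeff_def algebra_simps)

text \<open>For m = l + d the common factor is \<open>R * X\<close>, and (\<alpha> + 1 + l) + (d +
  1) = \<alpha> + 1 + l + 1 + d remains. At the top index l = m + 1 the polynomial of degree m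
  contributes nothing.\<close>

lemma jacobi_coeff_contiguous2:
  "jacobi_coeff (Suc m) \<alpha> (\<beta> + 1) l + jacobi_coeff m (\<alpha> + 1) (\<beta> + 1) l = jacobi_coeff (Suc m) (\<alpha> + 1) \<beta> l"
proof (cases "l \<le> m")
  case True
  then obtain d where m: "m = l + d" using le_Suc_ex by blast
  define c where "c = of_nat m + \<alpha> + \<beta> + 2"
  define X where "X = (- 1) ^ l * pochhammer (c + 1) l * inverse (fact l) * inverse (fact (Suc d))"
  define R where "R = pochhammer (\<alpha> + 1 + of_nat l + 1) d"
  have 1: "pochhammer (\<alpha> + 1 + of_nat l) (Suc d) = (\<alpha> + 1 + of_nat l) * R"
    "pochhammer (\<alpha> + 1 + of_nat l + 1) (Suc d) = (\<alpha> + 1 + of_nat l + 1 + of_nat d) * R"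
    unfolding R_def by (rule pochhammer_rec pochhammer_rec')+
  have 2: "of_nat m + (\<alpha> + 1) + (\<beta> + 1) + 1 = c + 1" "of_nat (Suc m) + (\<alpha> + 1) + \<beta> + 1 = c + 1"
    "of_nat (Suc m) + \<alpha> + (\<beta> + 1) + 1 = c + 1" "\<alpha> + 1 + 1 + of_nat l = \<alpha> + 1 + of_nat l + 1"
    "Suc m - l = Suc d" "m - l = d"
    by (simp_all add: c_def m)
  have "jacobi_coeff (Suc m) \<alpha> (\<beta> + 1) l = (\<alpha> + 1 + of_nat l) * R * X"
    using True by (subst jacobi_coeff_eq) (simp_all only: 2 1 X_def mult_ac le_Suc_eq simp_thms)
  moreover have "jacobi_coeff (Suc m) (\<alpha> + 1) \<beta> l = (\<alpha> + 1 + of_nat l + 1 + of_nat d) * R * X"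
    using True by (subst jacobi_coeff_eq) (simp_all only: 2 1 X_def mult_ac le_Suc_eq simp_thms)
  moreover have "jacobi_coeff m (\<alpha> + 1) (\<beta> + 1) l = R * X * (of_nat d + 1)"
    using True by (subst jacobi_coeff_eq) (simp_all only: 2 1 X_def R_def mult_ac inverse_fact_eq[of d])
  ultimately show ?thesis by (simp add: algebra_simps)
next
  case False
  then show ?thesis
    by (cases "l = Suc m") (simp_all add: jacobi_coeff_def add_ac)
qed

text \<open>The shift x (x+1)_n = (x+n) (x)_n of Pochhammer symbols, used in \<open>p\<close> and
  \<open>q\<close>, reduces the claim to e + l = (\<alpha> + 1 + l) + (m + \<beta> + 1).\<close>

lemma jacobi_coeff_contiguous3:
  "(of_nat m + \<alpha> + 1) * jacobi_coeff m \<alpha> (\<beta> + 1) l + (of_nat m + \<beta> + 1) * jacobi_coeff m (\<alpha> + 1) \<beta> l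
    = (of_nat m + \<alpha> + \<beta> + 2) * jacobi_coeff m (\<alpha> + 1) (\<beta> + 1) l"
proof (cases "l \<le> m")
  case True
  then obtain d where m: "m = l + d" using le_Suc_ex by blast
  define e where "e = of_nat m + \<alpha> + \<beta> + 2"
  define X where "X = (- 1) ^ l * inverse (fact l) * inverse (fact d :: complex)"
  define R where "R = pochhammer (\<alpha> + 1 + of_nat l + 1) d"
  have p: "(\<alpha> + 1 + of_nat l + of_nat d) * pochhammer (\<alpha> + 1 + of_nat l) d = (\<alpha> + 1 + of_nat l) * R"
    unfolding R_def by (metis pochhammer_rec pochhammer_rec')
  have q: "e * pochhammer (e + 1) l = (e + of_nat l) * pochhammer e l"
    by (metis pochhammer_rec pochhammer_rec')
  have 2: "of_nat m + (\<alpha> + 1) + (\<beta> + 1) + 1 = e + 1" "of_nat m + (\<alpha> + 1) + \<beta> + 1 = e"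
    "of_nat m + \<alpha> + (\<beta> + 1) + 1 = e" "\<alpha> + 1 + 1 + of_nat l = \<alpha> + 1 + of_nat l + 1" "m - l = d"
    by (simp_all add: e_def m)
  have 3: "of_nat m + \<alpha> + 1 = \<alpha> + 1 + of_nat l + of_nat d" by (simp add: m)
  have "(of_nat m + \<alpha> + 1) * jacobi_coeff m \<alpha> (\<beta> + 1) l
      = ((\<alpha> + 1 + of_nat l + of_nat d) * pochhammer (\<alpha> + 1 + of_nat l) d) * pochhammer e l * X"
    using True by (subst jacobi_coeff_eq) (simp_all only: 2 3 X_def mult_ac)
  moreover have "jacobi_coeff m (\<alpha> + 1) \<beta> l = R * pochhammer e l * X"
    using True by (subst jacobi_coeff_eq) (simp_all only: 2 R_def X_def mult_ac)
  moreover have "e * jacobi_coeff m (\<alpha> + 1) (\<beta> + 1) l = (e * pochhammer (e + 1) l) * R * X"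
    using True by (subst jacobi_coeff_eq) (simp_all only: 2 R_def X_def mult_ac)
  moreover have "e + of_nat l = (\<alpha> + 1 + of_nat l) + (of_nat m + \<beta> + 1)"
    by (simp add: e_def m)
  ultimately show ?thesis unfolding p q e_def[symmetric] by (simp add: algebra_simps)
qed (simp add: jacobi_coeff_def)

text \<open>For l \<le> m + 1 the coefficient of degree m + 1 is \<open>Y\<close>, and the two terms
  on the right amount to (m + 1 - l) Y and l Y.\<close>

lemma jacobi_coeff_contiguous4:
  "(of_nat m + 1) * jacobi_coeff (Suc m) \<alpha> \<beta> l = (of_nat m + \<alpha> + 1) * jacobi_coeff m \<alpha> (\<beta> + 1) l
    - (of_nat m + \<alpha> + \<beta> + 2) * (if l = 0 then 0 else jacobi_coeff m (\<alpha> + 1) (\<beta> + 1) (l - 1))"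
proof -
  define e where "e = of_nat m + \<alpha> + \<beta> + 2"
  define Y where "Y = (- 1) ^ l * pochhammer e l * pochhammer (\<alpha> + 1 + of_nat l) (Suc m - l)
      * inverse (fact l) * inverse (fact (Suc m - l))"
  have 2: "of_nat m + (\<alpha> + 1) + (\<beta> + 1) + 1 = e + 1" "of_nat (Suc m) + \<alpha> + \<beta> + 1 = e"
    "of_nat m + \<alpha> + (\<beta> + 1) + 1 = e"
    by (simp_all add: e_def)
  have 3: "(of_nat m + \<alpha> + 1) * jacobi_coeff m \<alpha> (\<beta> + 1) l = of_nat (Suc m - l) * Y"
  proof (cases "l \<le> m")
    case True
    then obtain d where m: "m = l + d" using le_Suc_ex by blast
    have d: "m - l = d" "Suc m - l = Suc d" and "of_nat m + \<alpha> + 1 = \<alpha> + 1 + of_nat l + of_nat d"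
      by (simp_all add: m)
    then have p: "pochhammer (\<alpha> + 1 + of_nat l) (Suc d)
        = (of_nat m + \<alpha> + 1) * pochhammer (\<alpha> + 1 + of_nat l) d"
      by (simp only: pochhammer_rec')
    have s: "of_nat (Suc d) = (of_nat d + 1 :: complex)" by simp
    show ?thesis
      using True by (subst jacobi_coeff_eq) (simp_all only: Y_def d p 2 inverse_fact_eq[of d] s mult_ac)
  qed (simp add: jacobi_coeff_def)
  have 4: "e * (if l = 0 then 0 else jacobi_coeff m (\<alpha> + 1) (\<beta> + 1) (l - 1)) = - of_nat l * Y" if "l \<le> Suc m"
  proof (cases l)
    case (Suc k)
    have s: "of_nat (Suc k) = (of_nat k + 1 :: complex)" "\<alpha> + 1 + (of_nat k + 1) = \<alpha> + 1 + 1 + of_nat k"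
      by simp_all
    have k: "k \<le> m" using that Suc by simp
    have "e * jacobi_coeff m (\<alpha> + 1) (\<beta> + 1) k = - of_nat l * Y"
      using k by (subst jacobi_coeff_eq) (simp_all only: Y_def Suc 2 inverse_fact_eq[of k] pochhammer_rec
        s diff_Suc_Suc power_Suc mult_1_left mult_minus1 mult_minus_left mult_minus_right minus_minus mult_ac)
    then show ?thesis by (simp add: Suc)
  qed simp
  show ?thesis
  proof (cases "l \<le> Suc m")
    case True
    have "jacobi_coeff (Suc m) \<alpha> \<beta> l = Y" using True by (simp only: jacobi_coeff_eq 2 Y_def)
    moreover have "(of_nat (Suc m - l) :: complex) + of_nat l = of_nat m + 1"
      using True by (simp flip: of_nat_add)
    then have "(of_nat m + 1) * Y = of_nat (Suc m - l) * Y + of_nat l * Y"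
      by (metis distrib_right)
    ultimately show ?thesis
      unfolding 3 4[OF True, unfolded e_def] by simp
  qed (simp add: jacobi_coeff_def)
qed

lemma jacobi_contiguous1:
  "jacobi (Suc m) \<alpha> \<beta> - half_diff * jacobi m (\<alpha> + 1) (\<beta> + 1) = jacobi (Suc m) \<alpha> (\<beta> + 1)"
  unfolding half_diff_times_jacobi jacobi_eq_sum[OF le_refl, of "Suc m"]
    sum_subtractf[symmetric] smult_diff_left[symmetric] jacobi_coeff_contiguous1 ..

lemma jacobi_contiguous2:
  "jacobi (Suc m) \<alpha> (\<beta> + 1) + jacobi m (\<alpha> + 1) (\<beta> + 1) = jacobi (Suc m) (\<alpha> + 1) \<beta>"
  unfolding jacobi_eq_sum[OF le_refl, of "Suc m"] jacobi_eq_sum[OF le_SucI[OF le_refl], of m]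
    sum.distrib[symmetric] smult_add_left[symmetric] jacobi_coeff_contiguous2 ..

lemma jacobi_contiguous3:
  "smult (of_nat m + \<alpha> + 1) (jacobi m \<alpha> (\<beta> + 1)) + smult (of_nat m + \<beta> + 1) (jacobi m (\<alpha> + 1) \<beta>)
    = smult (of_nat m + \<alpha> + \<beta> + 2) (jacobi m (\<alpha> + 1) (\<beta> + 1))"
  unfolding jacobi_eq_sum[OF le_refl, of m] smult_sum_right smult_smult
    sum.distrib[symmetric] smult_add_left[symmetric] jacobi_coeff_contiguous3 ..

lemma jacobi_contiguous4:
  "smult (of_nat m + 1) (jacobi (Suc m) \<alpha> \<beta>) = smult (of_nat m + \<alpha> + 1) (jacobi m \<alpha> (\<beta> + 1))
    - smult (of_nat m + \<alpha> + \<beta> + 2) (half_diff * jacobi m (\<alpha> + 1) (\<beta> + 1))"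
  unfolding half_diff_times_jacobi
  unfolding jacobi_eq_sum[OF le_refl, of "Suc m"] jacobi_eq_sum[OF le_SucI[OF le_refl], of m] smult_sum_right smult_smult
    sum_subtractf[symmetric] smult_diff_left[symmetric] jacobi_coeff_contiguous4 ..

subsection \<open>The recursion of the polynomials \<open>f_n\<close>\<close>

lemma homog_add: "homog n (P + Q) = homog n P + homog n Q"
proof -
  have "scale (a + b) f = scale a f + scale b f" for a b f
    by (metis add_pCons add.right_neutral smult_add_left)
  then show ?thesis by (simp add: homog_def sum.distrib)
qed

lemma homog_smult: "homog n (smult c P) = scale c (homog n P)"
proof -
  have "scale (a * b) f = scale a (scale b f)" for a b f by (simp add: mult.commute)
  then show ?thesis by (simp only: homog_def coeff_smult smult_sum_right)
qed

lemma homog_diff: "homog n (P - Q) = homog n P - homog n Q"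
  by (metis homog_add add_diff_cancel_right' diff_add_cancel)

text \<open>\<open>pCons 0 P\<close> is x P(x), and the extra factor z zbar of the higher degree
  turns x into (z^2 + zbar^2)/2.\<close>

lemma homog_Suc_pCons_0: "homog (Suc n) (pCons 0 P) = scale (1/2) (Z\<^sup>2 + Zbar\<^sup>2) * homog n P"
proof -
  have "homog (Suc n) (pCons 0 P) = (\<Sum>j\<le>n. scale (coeff P j)
      (scale (1/2) (Z\<^sup>2 + Zbar\<^sup>2) ^ Suc j * (Z * Zbar) ^ (n - j)))"
    unfolding homog_def by (subst sum.atMost_Suc_shift) simp
  also have "\<dots> = scale (1/2) (Z\<^sup>2 + Zbar\<^sup>2) * homog n P"
    unfolding homog_def sum_distrib_left
    by (intro sum.cong refl) (simp only: mult_smult_left mult_smult_right power_Suc mult_ac)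
  finally show ?thesis .
qed

lemma homog_Suc:
  assumes "degree P \<le> n"
  shows "homog (Suc n) P = Z * Zbar * homog n P"
proof -
  have "homog (Suc n) P = (\<Sum>j\<le>n. scale (coeff P j)
      (scale (1/2) (Z\<^sup>2 + Zbar\<^sup>2) ^ j * (Z * Zbar) ^ (Suc n - j)))"
    using assms by (simp add: homog_def coeff_eq_0)
  also have "\<dots> = Z * Zbar * homog n P"
    unfolding homog_def sum_distrib_left
    by (intro sum.cong refl)
      (simp add: Suc_diff_le mult_ac del: smult_add_right smult_power mult_smult_left flip: scale_eq)
  finally show ?thesis .
qed

lemma half_diff_mult: "half_diff * P = smult (1/2) P - pCons 0 (smult (1/2) P)"
  by (simp add: half_diff_def smult_pCons flip: smult_minus_left)

lemma const_half: "2 * const (1/2) = 1" "const (1/4) = const (1/2) * const (1/2)"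
  by (simp_all only: mult_2) (simp_all add: one_pCons)

text \<open>Multiplied by z zbar, (1 - x)/2 becomes -(z - zbar)^2/4.\<close>

lemma homog_half_diff:
  assumes "degree P \<le> n"
  shows "homog (Suc n) (half_diff * P) = const (- 1/4) * (Z - Zbar)\<^sup>2 * homog n P"
proof -
  have d: "degree (smult (1/2) P) \<le> n" using assms by simp
  have "homog (Suc n) (half_diff * P)
      = const (1/2) * (Z * Zbar * homog n P) - const (1/2) * (Z\<^sup>2 + Zbar\<^sup>2) * (const (1/2) * homog n P)"
    unfolding half_diff_mult homog_diff homog_Suc_pCons_0 homog_Suc[OF assms] homog_smult scale_eq ..
  also have "\<dots> = const (1/2) * const (1/2) * (2 * Z * Zbar - (Z\<^sup>2 + Zbar\<^sup>2)) * homog n P"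
  proof -
    have "const (1/2) * (Z * Zbar * homog n P) = const (1/2) * (const (1/2) * 2) * (Z * Zbar * homog n P)"
      using const_half(1) by (simp only: mult.commute mult_1_left)
    then show ?thesis by (simp only: right_diff_distrib left_diff_distrib mult_ac)
  qed
  also have "const (1/2) * const (1/2) = - const (- 1/4)" by simp
  finally show ?thesis by algebra
qed

lemma swap_homog [simp]: "swap (homog n P) = homog n P"
  unfolding homog_def by (simp add: add.commute mult.commute del: smult_add_right)

text \<open>The scalars A and B of the overview are best seen through A + B and A - B. For n = 2m +
  1 these are m + \<kappa>0 + 1/2 and m + \<kappa>1 + 1/2; for n = 2m they are 1/m and 1/(m +
  \<kappa>0 + \<kappa>1), if the denominators are nonzero.\<close>

definition recA :: "complex \<Rightarrow> complex \<Rightarrow> nat \<Rightarrow> complex" where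
  "recA \<kappa>0 \<kappa>1 n = (of_nat n + \<kappa>0 + \<kappa>1)
    / (if even n then of_nat n * (of_nat (n div 2) + \<kappa>0 + \<kappa>1) else 2)"

definition recB :: "complex \<Rightarrow> complex \<Rightarrow> nat \<Rightarrow> complex" where
  "recB \<kappa>0 \<kappa>1 n = (if even n then (\<kappa>0 + \<kappa>1) / (of_nat n * (of_nat (n div 2) + \<kappa>0 + \<kappa>1))
    else (\<kappa>0 - \<kappa>1) / 2)"

text \<open>The first two contiguous relations express the Jacobi polynomials in
  \<open>f_odd\<close>, here \<open>G1\<close> and \<open>G2\<close>, through those in
  \<open>f_even\<close>, here \<open>P\<close> and \<open>R\<close>. As the scalars in
  \<open>f_odd\<close> are A + B and A - B, a polynomial identity remains.\<close>

lemma f_odd_rec: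
  "f_odd \<kappa>0 \<kappa>1 m = const (recA \<kappa>0 \<kappa>1 (2 * m + 1)) * Z * f_even \<kappa>0 \<kappa>1 m
    + const (recB \<kappa>0 \<kappa>1 (2 * m + 1)) * Zbar * swap (f_even \<kappa>0 \<kappa>1 m)"
proof -
  define \<alpha> \<beta> where "\<alpha> = \<kappa>0 - 1/2" and "\<beta> = \<kappa>1 - 1/2"
  have ab: "\<kappa>0 + 1/2 = \<alpha> + 1" "\<kappa>1 + 1/2 = \<beta> + 1" by (simp_all add: \<alpha>_def \<beta>_def)
  define P where "P = homog m (jacobi m \<alpha> \<beta>)"
  define R where "R = (if m = 0 then 0 else homog (m - 1) (jacobi (m - 1) (\<alpha> + 1) (\<beta> + 1)))"
  define h where "h = const (1/2)"
  define G1 where "G1 = homog m (jacobi m \<alpha> (\<beta> + 1))"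
  define G2 where "G2 = homog m (jacobi m (\<alpha> + 1) \<beta>)"
  have h: "2 * h = 1" unfolding h_def by (rule const_half)
  have G: "G1 = P + h * h * (Z - Zbar)\<^sup>2 * R \<and> G2 = G1 + Z * Zbar * R"
  proof (cases m)
    case 0
    then show ?thesis by (simp add: G1_def G2_def P_def R_def jacobi_def)
  next
    case (Suc k)
    have G1: "G1 = P - const (- 1/4) * (Z - Zbar)\<^sup>2 * R"
      unfolding G1_def P_def R_def Suc
      by (simp add: homog_diff flip: jacobi_contiguous1 homog_half_diff degree_jacobi)
        (simp add: homog_half_diff degree_jacobi)
    have c: "const (- 1/4) = - (h * h)" by (simp add: h_def)
    have "G1 = P + h * h * (Z - Zbar)\<^sup>2 * R"
      unfolding G1 c by (simp only: mult_minus_left diff_minus_eq_add)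
    moreover have "G2 = G1 + Z * Zbar * R"
      unfolding G1_def G2_def R_def Suc
      by (simp add: homog_add homog_Suc degree_jacobi flip: jacobi_contiguous2)
    ultimately show ?thesis by simp
  qed
  define A B where "A = const (recA \<kappa>0 \<kappa>1 (2 * m + 1))" and "B = const (recB \<kappa>0 \<kappa>1 (2 * m + 1))"
  have p: "const (of_nat m + \<kappa>0 + 1/2) = A + B" and q: "const (of_nat m + \<kappa>1 + 1/2) = A - B"
    by (simp_all add: A_def B_def recA_def recB_def field_simps)
  have e: "f_even \<kappa>0 \<kappa>1 m = P + h * h * (Z\<^sup>2 - Zbar\<^sup>2) * R"
    unfolding f_even_def scale_eq const_half(2) by (simp add: P_def R_def \<alpha>_def \<beta>_def h_def ab)
  have "swap P = P" "swap R = R" "swap h = h" by (simp_all add: P_def R_def h_def)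
  then have e': "swap (f_even \<kappa>0 \<kappa>1 m) = P - h * h * (Z\<^sup>2 - Zbar\<^sup>2) * R"
    unfolding e swap_simps by (simp add: algebra_simps)
  have "f_odd \<kappa>0 \<kappa>1 m = (A + B) * (h * (Z + Zbar) * G1) + (A - B) * (h * (Z - Zbar) * G2)"
    unfolding f_odd_def scale_eq p q by (simp add: G1_def G2_def \<alpha>_def \<beta>_def h_def ab)
  also have "\<dots> = A * Z * (P + h * h * (Z\<^sup>2 - Zbar\<^sup>2) * R) + B * Zbar * (P - h * h * (Z\<^sup>2 - Zbar\<^sup>2) * R)"
    using G h by algebra
  finally show ?thesis unfolding e' unfolding e A_def B_def .
qed

text \<open>The last two contiguous relations express \<open>e * R\<close> and \<open>M * P\<close>
  through \<open>G1\<close> and \<open>G2\<close>. Multiplication by \<open>M * e\<close>, which is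
  nonzero by assumption, clears all denominators.\<close>

lemma f_even_rec:
  assumes "of_nat (Suc m) + \<kappa>0 + \<kappa>1 \<noteq> 0"
  shows "f_even \<kappa>0 \<kappa>1 (Suc m) = const (recA \<kappa>0 \<kappa>1 (2 * m + 2)) * Z * f_odd \<kappa>0 \<kappa>1 m
    + const (recB \<kappa>0 \<kappa>1 (2 * m + 2)) * Zbar * swap (f_odd \<kappa>0 \<kappa>1 m)"
proof -
  define \<alpha> \<beta> where "\<alpha> = \<kappa>0 - 1/2" and "\<beta> = \<kappa>1 - 1/2"
  have ab: "\<kappa>0 + 1/2 = \<alpha> + 1" "\<kappa>1 + 1/2 = \<beta> + 1" by (simp_all add: \<alpha>_def \<beta>_def)
  define P where "P = homog (Suc m) (jacobi (Suc m) \<alpha> \<beta>)"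
  define R where "R = homog m (jacobi m (\<alpha> + 1) (\<beta> + 1))"
  define h where "h = const (1/2)"
  define G1 where "G1 = homog m (jacobi m \<alpha> (\<beta> + 1))"
  define G2 where "G2 = homog m (jacobi m (\<alpha> + 1) \<beta>)"
  define p where "p = const (of_nat m + \<kappa>0 + 1/2)"
  define q where "q = const (of_nat m + \<kappa>1 + 1/2)"
  define e where "e = const (of_nat (Suc m) + \<kappa>0 + \<kappa>1)"
  define M where "M = const (of_nat (Suc m))"
  have h: "2 * h = 1" unfolding h_def by (rule const_half)
  have "e * R = const (of_nat m + \<alpha> + \<beta> + 2) * R"
    by (simp add: e_def \<alpha>_def \<beta>_def algebra_simps)
  also have "\<dots> = const (of_nat m + \<alpha> + 1) * G1 + const (of_nat m + \<beta> + 1) * G2"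
    unfolding R_def G1_def G2_def scale_eq[symmetric] homog_smult[symmetric] homog_add[symmetric]
      jacobi_contiguous3 ..
  also have "const (of_nat m + \<alpha> + 1) = p" by (simp add: p_def \<alpha>_def)
  also have "const (of_nat m + \<beta> + 1) = q" by (simp add: q_def \<beta>_def)
  finally have eR: "e * R = p * G1 + q * G2" .
  have "M * P = homog (Suc m) (smult (of_nat m + 1) (jacobi (Suc m) \<alpha> \<beta>))"
    by (simp add: M_def P_def homog_smult add.commute)
  also have "\<dots> = const (of_nat m + \<alpha> + 1) * (Z * Zbar * G1)
      - const (of_nat m + \<alpha> + \<beta> + 2) * (const (- 1/4) * (Z - Zbar)\<^sup>2 * R)"
    unfolding jacobi_contiguous4 homog_diff homog_smult homog_Suc[OF degree_jacobi]
      homog_half_diff[OF degree_jacobi] R_def G1_def scale_eq ..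
  also have "const (- 1/4) = - (h * h)" by (simp add: h_def)
  also have "const (of_nat m + \<alpha> + 1) = p" by (simp add: p_def \<alpha>_def)
  also have "const (of_nat m + \<alpha> + \<beta> + 2) = e" by (simp add: e_def \<alpha>_def \<beta>_def)
  finally have MP: "M * P = p * (Z * Zbar * G1) + e * (h * h * (Z - Zbar)\<^sup>2 * R)"
    by simp
  define A B where "A = const (recA \<kappa>0 \<kappa>1 (2 * m + 2))" and "B = const (recB \<kappa>0 \<kappa>1 (2 * m + 2))"
  have nz: "of_nat (Suc m) \<noteq> (0 :: complex)" by (simp del: of_nat_Suc)
  have A: "M * e * A = (M + e) * h" and B: "M * e * B = (e - M) * h"
  proof -
    define M0 where "M0 = (of_nat (Suc m) :: complex)"
    define e0 where "e0 = M0 + \<kappa>0 + \<kappa>1"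
    have "M0 \<noteq> 0" "e0 \<noteq> 0" using assms nz by (simp_all add: M0_def e0_def)
    moreover have "recA \<kappa>0 \<kappa>1 (2 * m + 2) = (M0 + e0) / (2 * M0 * e0)"
      "recB \<kappa>0 \<kappa>1 (2 * m + 2) = (e0 - M0) / (2 * M0 * e0)"
      by (simp_all add: recA_def recB_def M0_def e0_def algebra_simps)
    moreover have "M = const M0" "e = const e0" by (simp_all add: M_def e_def M0_def e0_def)
    ultimately show "M * e * A = (M + e) * h" "M * e * B = (e - M) * h"
      by (simp_all add: A_def B_def h_def)
  qed
  have "swap p = p" "swap q = q" "swap G1 = G1" "swap G2 = G2" "swap h = h"
    by (simp_all add: p_def q_def G1_def G2_def h_def)
  moreover have o: "f_odd \<kappa>0 \<kappa>1 m = p * (h * (Z + Zbar) * G1) + q * (h * (Z - Zbar) * G2)"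
    unfolding f_odd_def scale_eq by (simp add: G1_def G2_def p_def q_def \<alpha>_def \<beta>_def h_def ab)
  ultimately have o': "swap (f_odd \<kappa>0 \<kappa>1 m) = p * (h * (Z + Zbar) * G1) - q * (h * (Z - Zbar) * G2)"
    unfolding o swap_simps by (simp add: algebra_simps)
  have "M * e * f_even \<kappa>0 \<kappa>1 (Suc m) = M * e * (P + h * h * (Z\<^sup>2 - Zbar\<^sup>2) * R)"
    unfolding f_even_def scale_eq const_half(2) by (simp add: P_def R_def \<alpha>_def \<beta>_def h_def ab)
  also have "\<dots> = e * (M * P) + M * h * h * (Z\<^sup>2 - Zbar\<^sup>2) * (e * R)"
    by (simp add: algebra_simps)
  also have "\<dots> = ((M + e) * h) * Z * f_odd \<kappa>0 \<kappa>1 m + ((e - M) * h) * Zbar * swap (f_odd \<kappa>0 \<kappa>1 m)"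
    using MP eR h unfolding o' unfolding o by algebra
  also have "\<dots> = M * e * (A * Z * f_odd \<kappa>0 \<kappa>1 m + B * Zbar * swap (f_odd \<kappa>0 \<kappa>1 m))"
    unfolding A[symmetric] B[symmetric] by (simp only: distrib_left mult_ac)
  finally have "M * e * f_even \<kappa>0 \<kappa>1 (Suc m)
      = M * e * (A * Z * f_odd \<kappa>0 \<kappa>1 m + B * Zbar * swap (f_odd \<kappa>0 \<kappa>1 m))" .
  moreover have "M * e \<noteq> 0" using assms nz by (simp add: M_def e_def del: of_nat_Suc)
  ultimately show ?thesis unfolding A_def B_def by (metis mult_left_cancel)
qed

lemma f_poly_Suc:
  assumes "\<And>m. m \<ge> 1 \<Longrightarrow> of_nat m + \<kappa>0 + \<kappa>1 \<noteq> 0"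
  shows "f_poly \<kappa>0 \<kappa>1 (Suc n) = const (recA \<kappa>0 \<kappa>1 (Suc n)) * Z * f_poly \<kappa>0 \<kappa>1 n
    + const (recB \<kappa>0 \<kappa>1 (Suc n)) * Zbar * swap (f_poly \<kappa>0 \<kappa>1 n)"
proof (cases "even n")
  case True
  then obtain m where "n = 2 * m" by blast
  then show ?thesis using f_odd_rec[of \<kappa>0 \<kappa>1 m] by (simp add: f_poly_def)
next
  case False
  then obtain m where "n = 2 * m + 1" by (rule oddE)
  then show ?thesis using f_even_rec[of m \<kappa>0 \<kappa>1] assms[of "Suc m"] by (simp add: f_poly_def)
qed

lemma f_poly_0: "f_poly \<kappa>0 \<kappa>1 0 = 1"
  by (simp add: f_poly_def f_even_def homog_def jacobi_def flip: one_pCons)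

lemma recA_recB:
  assumes "n \<ge> 1"
  shows "recB \<kappa>0 \<kappa>1 n * (of_nat n + \<kappa>0 + \<kappa>1) = recA \<kappa>0 \<kappa>1 n * (\<kappa>0 + (- 1) ^ n * \<kappa>1)"
  by (simp add: recA_def recB_def)

text \<open>The second factor is (A + B)(A - B). It equals (m + \<kappa>0 + 1/2)(m + \<kappa>1 +
  1/2) for n = 2m and 1/((m + 1)(m + 1 + \<kappa>0 + \<kappa>1)) for n = 2m + 1, which is how
  consecutive structural constants differ.\<close>

lemma lam_Suc:
  assumes "\<And>m. m \<ge> 1 \<Longrightarrow> of_nat m + \<kappa>0 + \<kappa>1 \<noteq> 0"
    and "\<And>m::nat. of_nat m + \<kappa>0 + 1/2 \<noteq> 0" "\<And>m::nat. of_nat m + \<kappa>1 + 1/2 \<noteq> 0"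
  shows "lam \<kappa>0 \<kappa>1 (Suc n) * (recA \<kappa>0 \<kappa>1 (Suc n) ^ 2 - recB \<kappa>0 \<kappa>1 (Suc n) ^ 2) = lam \<kappa>0 \<kappa>1 n"
proof (cases "even n")
  case True
  then obtain m where n: "n = 2 * m" by blast
  have "recA \<kappa>0 \<kappa>1 (Suc n) ^ 2 - recB \<kappa>0 \<kappa>1 (Suc n) ^ 2 = (of_nat m + \<kappa>0 + 1/2) * (of_nat m + \<kappa>1 + 1/2)"
    by (simp add: recA_def recB_def n power2_eq_square field_simps)
  moreover have "pochhammer (\<kappa>0 + 1/2) (Suc m) = (of_nat m + \<kappa>0 + 1/2) * pochhammer (\<kappa>0 + 1/2) m"
    "pochhammer (\<kappa>1 + 1/2) (Suc m) = (of_nat m + \<kappa>1 + 1/2) * pochhammer (\<kappa>1 + 1/2) m"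
    by (simp_all add: pochhammer_rec' add_ac)
  ultimately show ?thesis using assms(2,3)[of m] by (simp add: lam_def n)
next
  case False
  then obtain m where n: "n = 2 * m + 1" by (rule oddE)
  define M where "M = (of_nat (Suc m) :: complex)"
  define e where "e = M + \<kappa>0 + \<kappa>1"
  have nz: "M \<noteq> 0" "e \<noteq> 0" using assms(1)[of "Suc m"] by (simp_all add: M_def e_def del: of_nat_Suc)
  have "recA \<kappa>0 \<kappa>1 (Suc n) = (M + e) / (2 * M * e)" "recB \<kappa>0 \<kappa>1 (Suc n) = (e - M) / (2 * M * e)"
    by (simp_all add: recA_def recB_def n M_def e_def algebra_simps)
  note AB = this
  have "recA \<kappa>0 \<kappa>1 (Suc n) ^ 2 - recB \<kappa>0 \<kappa>1 (Suc n) ^ 2 = ((M + e)^2 - (e - M)^2) / (2 * M * e)^2"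
    unfolding AB power_divide by (rule diff_divide_distrib[symmetric])
  also have "\<dots> = 1 / (M * e)"
    using nz by (simp add: power2_eq_square field_simps)
  finally have *: "recA \<kappa>0 \<kappa>1 (Suc n) ^ 2 - recB \<kappa>0 \<kappa>1 (Suc n) ^ 2 = 1 / (M * e)" .
  have p: "pochhammer (\<kappa>0 + \<kappa>1 + 1) (Suc m) = e * pochhammer (\<kappa>0 + \<kappa>1 + 1) m"
    "(fact (Suc m) :: complex) = M * fact m"
    by (simp_all add: pochhammer_rec' add_ac e_def M_def)
  have "lam \<kappa>0 \<kappa>1 (Suc n) = (M * e) * lam \<kappa>0 \<kappa>1 n"
    by (simp add: lam_def n p del: fact_Suc)
  then show ?thesis unfolding * using nz by simp
qed

subsection \<open>Dunkl operators\<close>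

lemma Z_minus_scale_Zbar_nonzero: "Z - scale \<eta> Zbar \<noteq> 0"
proof
  assume "Z - scale \<eta> Zbar = 0"
  then have "coef (Z ^ 1 * Zbar ^ 0 - scale \<eta> (Z ^ 0 * Zbar ^ 1)) 1 0 = 0"
    by simp
  then show False unfolding coef_diff coef_scale coef_monomial by simp
qed

text \<open>As z - \<eta> zbar is nonzero, an exact quotient is determined by multiplying back.
  Difference quotients are computed below by exhibiting the quotient.\<close>

lemma diff_quot_unique:
  assumes "\<eta> \<noteq> 0" "q * (Z - scale \<eta> Zbar) = f - reflect \<eta> f"
  shows "diff_quot \<eta> f = q"
  using diff_quot_exact[OF assms(1), of f] assms(2) Z_minus_scale_Zbar_nonzero
  by (metis mult_right_cancel)

text \<open>The denominator satisfies zbar - \<eta> z = -\<eta> (z - \<eta>^(-1) zbar), and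
  \<open>swap\<close> carries the reflection with \<eta> into the one with 1/\<eta>.\<close>

lemma swap_diff_quot:
  assumes "\<eta> \<noteq> 0"
  shows "scale \<eta> (swap (diff_quot \<eta> f)) = - diff_quot (inverse \<eta>) (swap f)"
proof -
  have "diff_quot (inverse \<eta>) (swap f) = - scale \<eta> (swap (diff_quot \<eta> f))"
  proof (rule diff_quot_unique)
    have "- scale \<eta> (swap (diff_quot \<eta> f)) * (Z - scale (inverse \<eta>) Zbar)
        = swap (diff_quot \<eta> f * (Z - scale \<eta> Zbar))"
      using assms by (simp add: algebra_simps smult_diff_right)
    also have "\<dots> = swap f - reflect (inverse \<eta>) (swap f)"
      unfolding diff_quot_exact[OF assms] using assms by (simp add: swap_reflect)
    finally show "- scale \<eta> (swap (diff_quot \<eta> f)) * (Z - scale (inverse \<eta>) Zbar)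
        = swap f - reflect (inverse \<eta>) (swap f)" .
  qed (use assms in simp)
  then show ?thesis by simp
qed

lemma swap_dzbar: "swap (dzbar f) = dz (swap f)"
  by (metis swap_dz swap_swap)

section \<open>Power sums over roots of unity\<close>

lemma omega_eq: "omega s ^ k = cis (pi * of_nat k / of_nat s)"
proof -
  have "omega s = cis (pi / of_nat s)"
    by (simp add: omega_def cis_conv_exp)
  then show ?thesis by (simp add: DeMoivre mult.commute)
qed

lemma omega_nonzero [simp]: "omega s \<noteq> 0"
  by (simp add: omega_def)

lemma omega_power_s: "s > 0 \<Longrightarrow> omega s ^ s = -1"
  by (simp add: omega_eq)

lemma omega_power_neq_1:
  assumes "0 < i" "i < s"
  shows "omega s ^ (2 * i) \<noteq> 1"
proof -
  have inj: "inj_on (\<lambda>k. cis (2 * pi * real k / real s)) {..<s}"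
    using bij_betw_roots_unity[of s] assms by (simp add: bij_betw_def)
  then have "cis (2 * pi * real i / real s) \<noteq> cis (2 * pi * real 0 / real s)"
    using inj_onD[OF inj, of i 0] assms by fastforce
  then show ?thesis by (simp add: omega_eq mult_ac)
qed

text \<open>A geometric sum of s terms whose ratio differs from 1 while the s-th power of the ratio
  is 1.\<close>

lemma sum_omega_even_power:
  assumes "0 < i" "i < s"
  shows "(\<Sum>j<s. (omega s ^ (2 * j)) ^ i) = 0"
proof -
  have "(\<Sum>j<s. (omega s ^ (2 * j)) ^ i) = (\<Sum>j<s. (omega s ^ (2 * i)) ^ j)"
    by (simp add: mult_ac flip: power_mult)
  also have "\<dots> = ((omega s ^ (2 * i)) ^ s - 1) / (omega s ^ (2 * i) - 1)"
    by (rule geometric_sum[OF omega_power_neq_1[OF assms]])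
  also have "(omega s ^ (2 * i)) ^ s = (omega s ^ s) ^ (2 * i)"
    by (simp add: mult_ac flip: power_mult)
  finally show ?thesis using assms by (simp add: omega_power_s)
qed

lemma sum_omega_odd_power:
  assumes "0 < i" "i < s"
  shows "(\<Sum>j<s. (omega s ^ (2 * j + 1)) ^ i) = 0"
  using sum_omega_even_power[OF assms]
  by (simp add: power_mult_distrib flip: sum_distrib_left)

text \<open>Under \<open>swap\<close>, \<eta> becomes 1/\<eta>, which permutes the even and the odd
  powers of omega separately; the factors -\<eta> in \<open>Tbar\<close> are those produced by
  \<open>swap_diff_quot\<close>.\<close>

lemma T_swap:
  assumes "s > 0"
  shows "T s \<kappa>0 \<kappa>1 (swap f) = swap (Tbar s \<kappa>0 \<kappa>1 f)"
proof -
  have 1: "omega s ^ (s + s) = 1"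
    unfolding power_add using omega_power_s[OF assms] by simp
  have "(\<Sum>j<s. diff_quot (inverse (omega s ^ (2*j))) (swap f))
      = (\<Sum>j<s. diff_quot (omega s ^ (2*j)) (swap f))"
  \<comment> \<open>The inverse of omega^(2j) is omega^(2(s-j)); the reduction modulo s keeps j = 0
    within the range of summation.\<close>
  proof (rule sum.reindex_bij_witness[where i = "\<lambda>j. (s - j) mod s" and j = "\<lambda>j. (s - j) mod s"])
    fix j assume "j \<in> {..<s}"
    then have "2 * j + 2 * ((s - j) mod s) = (if j = 0 then 0 else s + s)"
      by auto
    then have "omega s ^ (2 * j) * omega s ^ (2 * ((s - j) mod s)) = 1"
      by (metis 1 power_0 power_add)
    then show "diff_quot (omega s ^ (2 * ((s - j) mod s))) (swap f)
        = diff_quot (inverse (omega s ^ (2*j))) (swap f)"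
      using inverse_unique by metis
  next
    fix j assume "j \<in> {..<s}"
    then show "(s - (s - j) mod s) mod s = j" "(s - (s - j) mod s) mod s = j" by (cases "j = 0"; simp)+
  qed (use assms in auto)
  moreover have "(\<Sum>j<s. diff_quot (inverse (omega s ^ (2*j+1))) (swap f))
      = (\<Sum>j<s. diff_quot (omega s ^ (2*j+1)) (swap f))"
  proof (rule sum.reindex_bij_witness[where i = "\<lambda>j. s - Suc j" and j = "\<lambda>j. s - Suc j"])
    fix j assume j: "j \<in> {..<s}"
    then have "2 * j + 1 + (2 * (s - Suc j) + 1) = s + s" by simp
    then have "omega s ^ (2 * j + 1) * omega s ^ (2 * (s - Suc j) + 1) = 1"
      by (metis 1 power_add)
    then show "diff_quot (omega s ^ (2 * (s - Suc j) + 1)) (swap f)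
        = diff_quot (inverse (omega s ^ (2*j+1))) (swap f)"
      using inverse_unique by metis
  qed auto
  ultimately show ?thesis
    by (simp add: T_def Tbar_def swap_diff_quot sum_negf swap_dzbar del: power_Suc)
qed

text \<open>With e = \<eta> zbar, z^t F - e^t \<delta> G = F (z^t - e^t) + (F - \<delta> G) e^t.
  Both summands are divisible by z - e through a geometric sum, the second one because F - \<delta>
  G is (z^s - e^s) Q.\<close>

lemma diff_quot_Z_power_mult:
  assumes "\<eta> \<noteq> 0" and rfl: "reflect \<eta> F = const \<delta> * G"
    and Q: "(Z ^ s - const (\<eta> ^ s) * Zbar ^ s) * Q = F - const \<delta> * G"
  shows "diff_quot \<eta> (Z ^ t * F) = F * (\<Sum>i<t. scale (\<eta> ^ i) (Z ^ (t - Suc i) * Zbar ^ i))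
    + Q * (\<Sum>i<s. scale (\<eta> ^ (i + t)) (Z ^ (s - Suc i) * Zbar ^ (i + t)))"
proof (rule diff_quot_unique[OF assms(1)])
  define e where "e = scale \<eta> Zbar"
  have e: "e ^ n = scale (\<eta> ^ n) (Zbar ^ n)" for n
    by (simp add: e_def smult_power poly_const_pow)
  have geo: "(\<Sum>i<n. Z ^ (n - Suc i) * e ^ i) * (Z - e) = Z ^ n - e ^ n" for n
    using power_diff_sumr2[of e n Z] by (simp add: algebra_simps)
  have 1: "(\<Sum>i<t. scale (\<eta> ^ i) (Z ^ (t - Suc i) * Zbar ^ i)) = (\<Sum>i<t. Z ^ (t - Suc i) * e ^ i)"
    by (simp add: e)
  have 2: "(\<Sum>i<s. scale (\<eta> ^ (i + t)) (Z ^ (s - Suc i) * Zbar ^ (i + t)))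
      = (\<Sum>i<s. Z ^ (s - Suc i) * e ^ i) * e ^ t"
    unfolding sum_distrib_right
  proof (intro sum.cong refl)
    fix i
    have *: "e ^ i * e ^ t = e ^ (i + t)" by (simp only: power_add)
    show "scale (\<eta> ^ (i + t)) (Z ^ (s - Suc i) * Zbar ^ (i + t)) = Z ^ (s - Suc i) * e ^ i * e ^ t"
      unfolding mult.assoc * unfolding e by simp
  qed
  have s: "const (\<eta> ^ s) * Zbar ^ s = e ^ s" by (simp add: e)
  have "(F * (\<Sum>i<t. Z ^ (t - Suc i) * e ^ i) + Q * ((\<Sum>i<s. Z ^ (s - Suc i) * e ^ i) * e ^ t)) * (Z - e)
      = F * ((\<Sum>i<t. Z ^ (t - Suc i) * e ^ i) * (Z - e)) + Q * ((\<Sum>i<s. Z ^ (s - Suc i) * e ^ i) * (Z - e)) * e ^ t"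
    by (simp only: distrib_right distrib_left mult_ac)
  also have "\<dots> = F * (Z ^ t - e ^ t) + (F - const \<delta> * G) * e ^ t"
    unfolding geo Q[symmetric] s by (simp only: mult_ac)
  also have "\<dots> = Z ^ t * F - e ^ t * (const \<delta> * G)"
    by (simp only: ring_distribs mult_ac) simp
  also have "\<dots> = Z ^ t * F - reflect \<eta> (Z ^ t * F)"
    unfolding reflect_simps rfl e_def ..
  finally show "(F * (\<Sum>i<t. scale (\<eta> ^ i) (Z ^ (t - Suc i) * Zbar ^ i))
    + Q * (\<Sum>i<s. scale (\<eta> ^ (i + t)) (Z ^ (s - Suc i) * Zbar ^ (i + t)))) * (Z - scale \<eta> Zbar)
      = Z ^ t * F - reflect \<eta> (Z ^ t * F)"
    unfolding 1 2 unfolding e_def .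
qed

lemma scale_sum_left: "(\<Sum>j\<in>A. scale (c j) f) = scale (\<Sum>j\<in>A. c j) f"
proof (induction A rule: infinite_finite_induct)
  case (insert x A)
  then show ?case by (simp flip: smult_add_left)
qed simp_all

text \<open>Summation over j kills every term of the two geometric sums in which the exponent of
  \<eta> is not a multiple of s. Without the extra factor \<eta>, exponent 0 survives in the first
  sum and s in the second; with it, all exponents rise by 1 and only s in the second sum is
  left.\<close>

lemma sum_diff_quot:
  fixes \<eta> :: "nat \<Rightarrow> complex"
  assumes "s > 0" and nz: "\<And>j. \<eta> j \<noteq> 0" and pow: "\<And>j. \<eta> j ^ s = \<epsilon>"
    and sum0: "\<And>i. 0 < i \<Longrightarrow> i < s \<Longrightarrow> (\<Sum>j<s. \<eta> j ^ i) = 0"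
    and rfl: "\<And>j. reflect (\<eta> j) F = const \<delta> * G"
    and Q: "(Z ^ s - const \<epsilon> * Zbar ^ s) * Q = F - const \<delta> * G"
  shows "1 \<le> t \<Longrightarrow> t \<le> s \<Longrightarrow> (\<Sum>j<s. diff_quot (\<eta> j) (Z ^ t * F))
      = of_nat s * Z ^ (t - 1) * (F + const \<epsilon> * Zbar ^ s * Q)" (is "_ \<Longrightarrow> _ \<Longrightarrow> ?A")
    and "t < s \<Longrightarrow> (\<Sum>j<s. scale (\<eta> j) (diff_quot (\<eta> j) (Z ^ t * F)))
      = of_nat s * (const \<epsilon> * Z ^ t * Zbar ^ (s - 1) * Q)" (is "_ \<Longrightarrow> ?B")
proof -
  define S where "S k = (\<Sum>j<s. \<eta> j ^ k)" for k
  have S0: "S 0 = of_nat s" by (simp add: S_def)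
  have S: "S k = 0" if "0 < k" "k < s" for k using sum0[OF that] by (simp add: S_def)
  have Ss: "S (s + k) = \<epsilon> * S k" for k
    by (simp add: S_def power_add pow sum_distrib_left)
  have Sk: "S k = (if k = s then of_nat s * \<epsilon> else 0)" if "0 < k" "k < 2 * s" for k
    using S[of k] S[of "k - s"] Ss[of "k - s"] S0 that by (cases "k < s"; cases "k = s") auto
  have dq: "diff_quot (\<eta> j) (Z ^ t * F) = F * (\<Sum>i<t. scale (\<eta> j ^ i) (Z ^ (t - Suc i) * Zbar ^ i))
    + Q * (\<Sum>i<s. scale (\<eta> j ^ (i + t)) (Z ^ (s - Suc i) * Zbar ^ (i + t)))" for j
    by (rule diff_quot_Z_power_mult[OF nz rfl]) (simp only: pow Q)
  have sw: "(\<Sum>j<s. \<Sum>i<n. H j i) = (\<Sum>i<n. \<Sum>j<s. H j i)" for n and H :: "nat \<Rightarrow> nat \<Rightarrow> zpoly"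
    by (rule sum.swap)
  show ?A if t: "1 \<le> t" "t \<le> s"
  proof -
    have "(\<Sum>j<s. diff_quot (\<eta> j) (Z ^ t * F))
        = F * (\<Sum>i<t. scale (S i) (Z ^ (t - Suc i) * Zbar ^ i))
        + Q * (\<Sum>i<s. scale (S (i + t)) (Z ^ (s - Suc i) * Zbar ^ (i + t)))"
      unfolding dq sum.distrib sum_distrib_left[symmetric] S_def scale_sum_left[symmetric]
        sw[of "\<lambda>j i. scale (\<eta> j ^ i) (Z ^ (t - Suc i) * Zbar ^ i)" t]
        sw[of "\<lambda>j i. scale (\<eta> j ^ (i + t)) (Z ^ (s - Suc i) * Zbar ^ (i + t))" s] ..
    also have "(\<Sum>i<t. scale (S i) (Z ^ (t - Suc i) * Zbar ^ i))
        = (\<Sum>i<t. if i = 0 then of_nat s * Z ^ (t - 1) else 0)"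
      using t S by (intro sum.cong) (auto simp: S0 simp flip: const_of_nat)
    also have "\<dots> = of_nat s * Z ^ (t - 1)"
      using t by simp
    also have "(\<Sum>i<s. scale (S (i + t)) (Z ^ (s - Suc i) * Zbar ^ (i + t)))
        = (\<Sum>i<s. if i = s - t then const (of_nat s * \<epsilon>) * Z ^ (t - 1) * Zbar ^ s else 0)"
      using t by (intro sum.cong) (auto simp: Sk simp flip: const_of_nat)
    also have "\<dots> = of_nat s * const \<epsilon> * Z ^ (t - 1) * Zbar ^ s"
      using t assms(1) by (simp flip: const_of_nat)
    finally show ?thesis by (simp only: distrib_left mult_ac)
  qed
  show ?B if t: "t < s"
  proof -
    have *: "scale c (F * (\<Sum>i<t. scale (c ^ i) (X i)) + Q * (\<Sum>i<s. scale (c ^ (i + t)) (Y i)))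
        = F * (\<Sum>i<t. scale (c ^ Suc i) (X i)) + Q * (\<Sum>i<s. scale (c ^ (Suc i + t)) (Y i))" for c X Y
      by (simp add: smult_add_right smult_sum_right mult.commute flip: mult_smult_right)
    have "(\<Sum>j<s. scale (\<eta> j) (diff_quot (\<eta> j) (Z ^ t * F)))
        = F * (\<Sum>i<t. scale (S (Suc i)) (Z ^ (t - Suc i) * Zbar ^ i))
        + Q * (\<Sum>i<s. scale (S (Suc i + t)) (Z ^ (s - Suc i) * Zbar ^ (i + t)))"
      unfolding dq * sum.distrib sum_distrib_left[symmetric] S_def scale_sum_left[symmetric]
        sw[of "\<lambda>j i. scale (\<eta> j ^ Suc i) (Z ^ (t - Suc i) * Zbar ^ i)" t]
        sw[of "\<lambda>j i. scale (\<eta> j ^ (Suc i + t)) (Z ^ (s - Suc i) * Zbar ^ (i + t))" s] ..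
    also have "(\<Sum>i<t. scale (S (Suc i)) (Z ^ (t - Suc i) * Zbar ^ i)) = 0"
      using t S by simp
    also have "(\<Sum>i<s. scale (S (Suc i + t)) (Z ^ (s - Suc i) * Zbar ^ (i + t)))
        = (\<Sum>i<s. if i = s - Suc t then const (of_nat s * \<epsilon>) * Z ^ t * Zbar ^ (s - 1) else 0)"
      using t by (intro sum.cong) (auto simp: Sk simp flip: const_of_nat)
    also have "\<dots> = of_nat s * const \<epsilon> * Z ^ t * Zbar ^ (s - 1)"
      using t assms(1) by (simp flip: const_of_nat)
    finally show ?thesis by (simp only: mult_zero_right add_0_left mult_ac)
  qed
qed

lemma diff_quot_add:
  assumes "\<eta> \<noteq> 0"
  shows "diff_quot \<eta> (f + g) = diff_quot \<eta> f + diff_quot \<eta> g"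
  by (rule diff_quot_unique[OF assms])
    (simp only: distrib_right diff_quot_exact[OF assms] reflect_simps, simp)

lemma diff_quot_invariant_mult:
  assumes "\<eta> \<noteq> 0" "reflect \<eta> p = p"
  shows "diff_quot \<eta> (p * f) = p * diff_quot \<eta> f"
proof (rule diff_quot_unique[OF assms(1)])
  show "p * diff_quot \<eta> f * (Z - scale \<eta> Zbar) = p * f - reflect \<eta> (p * f)"
    unfolding mult.assoc diff_quot_exact[OF assms(1)] reflect_simps assms(2) by (rule right_diff_distrib)
qed

text \<open>A factor fixed by all reflections passes through the difference quotients, so that only
  \<open>dz\<close> acts on it. This applies to constants and to powers of z zbar.\<close>

lemma T_invariant_mult:
  assumes "\<And>\<eta>. \<eta> \<noteq> 0 \<Longrightarrow> reflect \<eta> p = p"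
  shows "T s \<kappa>0 \<kappa>1 (p * f) = dz p * f + p * T s \<kappa>0 \<kappa>1 f"
proof -
  have *: "diff_quot (omega s ^ k) (p * f) = p * diff_quot (omega s ^ k) f" for k
    by (rule diff_quot_invariant_mult) (simp_all add: assms)
  show ?thesis
    unfolding T_def * dz_mult sum_distrib_left[symmetric] by (simp add: distrib_left)
qed

lemma T_scale: "T s \<kappa>0 \<kappa>1 (scale c f) = scale c (T s \<kappa>0 \<kappa>1 f)"
  using T_invariant_mult[of "const c"] reflect_simps(8) dz_simps(4) by (metis scale_eq mult_zero_left add_0_left)

lemma T_add: "T s \<kappa>0 \<kappa>1 (f + g) = T s \<kappa>0 \<kappa>1 f + T s \<kappa>0 \<kappa>1 g"
  by (simp add: T_def diff_quot_add sum.distrib smult_add_right)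

lemma T_sum: "T s \<kappa>0 \<kappa>1 (sum h A) = (\<Sum>x\<in>A. T s \<kappa>0 \<kappa>1 (h x))"
  by (induction A rule: infinite_finite_induct) (simp_all add: T_add)

lemma T_diff: "T s \<kappa>0 \<kappa>1 (f - g) = T s \<kappa>0 \<kappa>1 f - T s \<kappa>0 \<kappa>1 g"
  using T_add[of s \<kappa>0 \<kappa>1 "f - g" g] by simp

lemma Tbar_eq:
  assumes "s > 0"
  shows "Tbar s \<kappa>0 \<kappa>1 f = swap (T s \<kappa>0 \<kappa>1 (swap f))"
  using T_swap[OF assms, of \<kappa>0 \<kappa>1 f] by simp

subsection \<open>The action of \<open>T\<close> and \<open>Tbar\<close> on \<open>z^t f_n(z^s)\<close>\<close>

locale dihedral =
  fixes s :: nat and \<kappa>0 \<kappa>1 :: complex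
  assumes s: "s \<ge> 2"
    and half0: "\<And>m::nat. m \<ge> 1 \<Longrightarrow> - \<kappa>0 + 1/2 \<noteq> of_nat m"
    and half1: "\<And>m::nat. m \<ge> 1 \<Longrightarrow> - \<kappa>1 + 1/2 \<noteq> of_nat m"
    and no_int: "\<And>m::nat. m \<ge> 1 \<Longrightarrow> - of_nat s * (\<kappa>0 + \<kappa>1) \<noteq> of_nat m"
begin

lemma s_pos: "s > 0" using s by simp

lemma kappa0_shift_nonzero: "of_nat m + \<kappa>0 + 1/2 \<noteq> 0"
proof
  assume "of_nat m + \<kappa>0 + 1/2 = 0"
  moreover have "(of_nat m + \<kappa>0 + 1/2) + (- \<kappa>0 + 1/2) = of_nat (Suc m)" by simp
  ultimately show False using half0[of "Suc m"] by simp
qed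

lemma kappa1_shift_nonzero: "of_nat m + \<kappa>1 + 1/2 \<noteq> 0"
proof
  assume "of_nat m + \<kappa>1 + 1/2 = 0"
  moreover have "(of_nat m + \<kappa>1 + 1/2) + (- \<kappa>1 + 1/2) = of_nat (Suc m)" by simp
  ultimately show False using half1[of "Suc m"] by simp
qed

definition \<gamma> :: complex where "\<gamma> = of_nat s * \<kappa>0 + of_nat s * \<kappa>1"

lemma gamma_shift_nonzero:
  assumes "m \<ge> 1"
  shows "of_nat m + \<gamma> \<noteq> 0"
proof
  assume "of_nat m + \<gamma> = 0"
  moreover have "(of_nat m + \<gamma>) + (- of_nat s * (\<kappa>0 + \<kappa>1)) = of_nat m"
    by (simp add: \<gamma>_def algebra_simps)
  ultimately show False using no_int[OF assms] by simp
qed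

lemma kappa_sum_nonzero:
  assumes "m \<ge> 1"
  shows "of_nat m + \<kappa>0 + \<kappa>1 \<noteq> 0"
proof
  assume "of_nat m + \<kappa>0 + \<kappa>1 = 0"
  then have "of_nat s * (of_nat m + \<kappa>0 + \<kappa>1) = 0" by simp
  then have "of_nat (s * m) + \<gamma> = 0" by (simp add: \<gamma>_def algebra_simps)
  then show False using gamma_shift_nonzero[of "s * m"] assms s_pos by simp
qed

definition F :: "nat \<Rightarrow> zpoly" where "F n = subst (f_poly \<kappa>0 \<kappa>1 n) (Z ^ s) (Zbar ^ s)"

definition A :: "nat \<Rightarrow> zpoly" where "A n = const (recA \<kappa>0 \<kappa>1 n)"
definition B :: "nat \<Rightarrow> zpoly" where "B n = const (recB \<kappa>0 \<kappa>1 n)"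

lemma subst_swap: "subst (swap f) (Z ^ s) (Zbar ^ s) = swap (subst f (Z ^ s) (Zbar ^ s))"
  by (simp add: swap_def subst_subst)

lemma F_0: "F 0 = 1" by (simp add: F_def f_poly_0)

lemma F_Suc: "F (Suc n) = A (Suc n) * Z ^ s * F n + B (Suc n) * Zbar ^ s * swap (F n)"
proof -
  have "f_poly \<kappa>0 \<kappa>1 (Suc n) = const (recA \<kappa>0 \<kappa>1 (Suc n)) * Z * f_poly \<kappa>0 \<kappa>1 n
      + const (recB \<kappa>0 \<kappa>1 (Suc n)) * Zbar * swap (f_poly \<kappa>0 \<kappa>1 n)"
    by (rule f_poly_Suc) (rule kappa_sum_nonzero)
  then show ?thesis
    unfolding F_def A_def B_def
    by (simp only: subst_add subst_mult subst_const subst_swap subst_Z subst_Zbar)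
qed

lemma swap_AB [simp]: "swap (A n) = A n" "swap (B n) = B n"
  by (simp_all add: A_def B_def)

lemma swap_F_Suc: "swap (F (Suc n)) = A (Suc n) * Zbar ^ s * swap (F n) + B (Suc n) * Z ^ s * F n"
  by (simp add: F_Suc)

text \<open>Such a reflection exchanges z^s and zbar^s up to the factor \<epsilon>, and
  \<open>F n\<close> has degree n in these powers. \<open>F n\<close> and its swap are treated
  together because the recursion mixes them.\<close>

lemma reflect_F:
  assumes "\<eta> \<noteq> 0" "\<eta> ^ s = \<epsilon>" "\<epsilon> * \<epsilon> = 1"
  shows "reflect \<eta> (F n) = const (\<epsilon> ^ n) * swap (F n) \<and> reflect \<eta> (swap (F n)) = const (\<epsilon> ^ n) * F n"
proof (induction n)
  case 0
  show ?case by (simp add: F_0 flip: one_pCons)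
next
  case (Suc n)
  have "inverse \<eta> ^ s = \<epsilon>"
    using assms by (metis inverse_unique power_inverse)
  then have x: "reflect \<eta> (Z ^ s) = const \<epsilon> * Zbar ^ s" "reflect \<eta> (Zbar ^ s) = const \<epsilon> * Z ^ s"
    using assms(2) by (simp_all add: smult_power poly_const_pow)
  have AB: "reflect \<eta> (A n) = A n" "reflect \<eta> (B n) = B n" for n
    unfolding A_def B_def by (rule reflect_simps)+
  have e: "const (\<epsilon> ^ Suc n) = const \<epsilon> * const (\<epsilon> ^ n)" by simp
  show ?case
    unfolding F_Suc swap_simps swap_AB swap_swap reflect_simps(3,5) AB x Suc[THEN conjunct1] Suc[THEN conjunct2] e
    by (simp only: distrib_left mult_ac simp_thms)
qed

text \<open>Euler's identity for degree n s. It recovers the z-derivative from the zbar-derivative,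
  which is the one that \<open>F_quotients\<close> describes.\<close>

lemma euler_F: "Z * dz (F n) + Zbar * dzbar (F n) = of_nat (n * s) * F n"
proof (induction n)
  case 0
  show ?case by (simp add: F_0)
next
  case (Suc n)
  have "swap (Z * dz (F n) + Zbar * dzbar (F n)) = swap (of_nat (n * s) * F n)"
    unfolding Suc ..
  then have Suc': "Zbar * dzbar (swap (F n)) + Z * dz (swap (F n)) = of_nat (n * s) * swap (F n)"
    by (simp add: swap_dz swap_dzbar)
  have "dz (A n) = 0" "dz (B n) = 0" "dzbar (A n) = 0" "dzbar (B n) = 0" for n
    by (simp_all add: A_def B_def)
  then have "Z * dz (F (Suc n)) + Zbar * dzbar (F (Suc n))
      = A (Suc n) * ((Z * dz (Z ^ s)) * F n + Z ^ s * (Z * dz (F n) + Zbar * dzbar (F n)))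
      + B (Suc n) * ((Zbar * dzbar (Zbar ^ s)) * swap (F n)
        + Zbar ^ s * (Zbar * dzbar (swap (F n)) + Z * dz (swap (F n))))"
    by (simp add: F_Suc dz_mult dzbar_mult algebra_simps)
  also have "\<dots> = of_nat (Suc n * s) * F (Suc n)"
    unfolding Suc Suc' dz_Z_power dzbar_Zbar_power F_Suc
    by (simp add: algebra_simps)
  finally show ?case .
qed

lemma AB_relation:
  "B (Suc n) * (of_nat (Suc n) + const \<kappa>0 + const \<kappa>1)
    = A (Suc n) * (const \<kappa>0 - const ((- 1) ^ n) * const \<kappa>1)"
  using arg_cong[OF recA_recB[of "Suc n" \<kappa>0 \<kappa>1], of const]
  unfolding A_def B_def const_of_nat[symmetric] by simp

text \<open>The quotients are those in the two kinds of reflection terms of \<open>T\<close> for \<open>s = 1\<close>, with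
  \<open>(z, zbar)\<close> replaced by \<open>(z^s, zbar^s)\<close>; the last equation is the case \<open>t = 0\<close> of
  \<open>Tbar (z^t F) = 0\<close>.\<close>

lemma F_quotients:
  "\<exists>Qp Qm. (Z ^ s - Zbar ^ s) * Qp = F n - swap (F n)
    \<and> (Z ^ s + Zbar ^ s) * Qm = F n - const ((- 1) ^ n) * swap (F n)
    \<and> swap Qp = Qp \<and> swap Qm = - const ((- 1) ^ n) * Qm
    \<and> Zbar * dzbar (F n) = of_nat s * Zbar ^ s * (const \<kappa>0 * Qp - const \<kappa>1 * Qm)"
proof (induction n)
  case 0
  show ?case by (rule exI[of _ 0], rule exI[of _ 0]) (simp add: F_0 flip: one_pCons)
next
  case (Suc n)
  define d where "d = const ((- 1) ^ n)"
  define G where "G = F n"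
  define H where "H = swap (F n)"
  define a where "a = A (Suc n)"
  define b where "b = B (Suc n)"
  define x y where "x = Z ^ s" and "y = Zbar ^ s"
  define k0 k1 where "k0 = const \<kappa>0" and "k1 = const \<kappa>1"
  have dd: "d * d = 1" by (simp add: d_def flip: power_mult_distrib one_pCons)
  have dS: "const ((- 1) ^ Suc n) = - d" by (simp add: d_def)
  from Suc obtain Qp Qm where Q: "(x - y) * Qp = G - H" "(x + y) * Qm = G - d * H"
    "swap Qp = Qp" "swap Qm = - d * Qm"
    "Zbar * dzbar (F n) = of_nat s * y * (k0 * Qp - k1 * Qm)"
    unfolding d_def G_def H_def x_def y_def k0_def k1_def by blast
  have sw: "swap x = y" "swap y = x" "swap a = a" "swap b = b" "swap G = H" "swap H = G" "swap d = d"
    "swap k0 = k0" "swap k1 = k1"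
    by (simp_all add: x_def y_def a_def b_def G_def H_def d_def k0_def k1_def)
  have FS: "F (Suc n) = a * x * G + b * y * H" "swap (F (Suc n)) = a * y * H + b * x * G"
    unfolding swap_F_Suc F_Suc by (simp_all add: a_def b_def x_def y_def G_def H_def)
  have "Z * dz (swap (F n)) = swap (Zbar * dzbar (F n))" by (simp add: swap_dzbar)
  also have "\<dots> = of_nat s * x * (k0 * Qp + d * k1 * Qm)"
    unfolding Q(5) by (simp add: sw Q(3,4) algebra_simps)
  finally have Zdz: "Z * dz H = of_nat s * x * (k0 * Qp + d * k1 * Qm)" unfolding H_def .
  \<comment> \<open>The swapped induction hypothesis gives the z-derivative of \<open>H\<close>;
    Euler's identity converts it into the zbar-derivative that the recursion calls for.\<close>
  have "swap (Z * dz (F n) + Zbar * dzbar (F n)) = swap (of_nat (n * s) * F n)"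
    unfolding euler_F ..
  then have ZbH: "Zbar * dzbar H = of_nat (n * s) * H - of_nat s * x * (k0 * Qp + d * k1 * Qm)"
    unfolding Zdz[symmetric] H_def by (simp add: swap_dz swap_dzbar algebra_simps)
  have "dzbar a = 0" "dzbar b = 0" "dzbar x = 0"
    by (simp_all add: a_def b_def A_def B_def x_def)
  then have "Zbar * dzbar (F (Suc n))
      = a * x * (Zbar * dzbar G) + b * ((Zbar * dzbar y) * H + y * (Zbar * dzbar H))"
    by (simp add: FS dzbar_mult algebra_simps)
  also have "\<dots> = a * x * (of_nat s * y * (k0 * Qp - k1 * Qm))
      + b * (of_nat s * y * H + y * (of_nat (n * s) * H - of_nat s * x * (k0 * Qp + d * k1 * Qm)))"
    unfolding ZbH G_def Q(5) y_def dzbar_Zbar_power ..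
  also have "\<dots> = of_nat s * y * (a * x * (k0 * Qp - k1 * Qm) - b * x * (k0 * Qp + d * k1 * Qm)
      + (b * of_nat (Suc n)) * H)"
    by (simp add: algebra_simps)
  \<comment> \<open>The values of A and B enter only here: their relation absorbs the factor n + 1
    into the terms with \<kappa>0 and \<kappa>1.\<close>
  also have "b * of_nat (Suc n) = a * (k0 - d * k1) - b * k0 - b * k1"
  proof -
    have "b * (of_nat (Suc n) + k0 + k1) = a * (k0 - d * k1)"
      unfolding a_def b_def k0_def k1_def d_def by (rule AB_relation)
    then show ?thesis by algebra
  qed
  also have "a * x * (k0 * Qp - k1 * Qm) - b * x * (k0 * Qp + d * k1 * Qm)
      + (a * (k0 - d * k1) - b * k0 - b * k1) * H
    = k0 * ((a - b) * (x * Qp + H)) - k1 * ((a + d * b) * (x * Qm + d * H))"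
    using dd by algebra
  finally have "Zbar * dzbar (F (Suc n)) = of_nat s * y
      * (k0 * ((a - b) * (x * Qp + H)) - k1 * ((a + d * b) * (x * Qm + d * H)))" .
  \<comment> \<open>The new quotients stem from x G - y H = x (G - H) + (x - y) H and x G + d y H =
    x (G - d H) + d (x + y) H, with scalars a - b and a + d b.\<close>
  moreover have "(x - y) * ((a - b) * (x * Qp + H)) = F (Suc n) - swap (F (Suc n))"
    using Q(1) unfolding FS(2) unfolding FS(1) by algebra
  moreover have "(x + y) * ((a + d * b) * (x * Qm + d * H)) = F (Suc n) - (- d) * swap (F (Suc n))"
    using Q(2) dd unfolding FS(2) unfolding FS(1) by algebra
  moreover have "swap ((a - b) * (x * Qp + H)) = (a - b) * (x * Qp + H)"
    using Q(1) unfolding swap_simps sw Q(3) by algebra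
  moreover have "swap ((a + d * b) * (x * Qm + d * H)) = - (- d) * ((a + d * b) * (x * Qm + d * H))"
    using Q(2) dd unfolding swap_simps sw Q(4) by algebra
  ultimately show ?case
    unfolding dS x_def[symmetric] y_def[symmetric] k0_def[symmetric] k1_def[symmetric] by blast
qed

lemma omega_even_power_s: "(omega s ^ (2 * j)) ^ s = 1"
  and omega_odd_power_s: "(omega s ^ (2 * j + 1)) ^ s = - 1"
proof -
  have *: "(omega s ^ k) ^ s = (- 1) ^ k" for k
    by (metis omega_power_s[OF s_pos] power_mult mult.commute)
  then show "(omega s ^ (2 * j)) ^ s = 1" "(omega s ^ (2 * j + 1)) ^ s = - 1"
    unfolding * by simp_all
qed

text \<open>The even powers of omega have s-th power \<epsilon> = 1 and reflect \<open>F n\<close>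
  with \<delta> = 1; the odd ones have \<epsilon> = -1 and \<delta> = (-1)^n.\<close>

lemma sum_diff_quot_F:
  assumes Qp: "(Z ^ s - Zbar ^ s) * Qp = F n - swap (F n)"
    and Qm: "(Z ^ s + Zbar ^ s) * Qm = F n - const ((- 1) ^ n) * swap (F n)"
  shows "1 \<le> t \<Longrightarrow> t \<le> s \<Longrightarrow> (\<Sum>j<s. diff_quot (omega s ^ (2 * j)) (Z ^ t * F n))
      = of_nat s * Z ^ (t - 1) * (F n + Zbar ^ s * Qp)"
    and "1 \<le> t \<Longrightarrow> t \<le> s \<Longrightarrow> (\<Sum>j<s. diff_quot (omega s ^ (2 * j + 1)) (Z ^ t * F n))
      = of_nat s * Z ^ (t - 1) * (F n - Zbar ^ s * Qm)"
    and "t < s \<Longrightarrow> (\<Sum>j<s. scale (omega s ^ (2 * j)) (diff_quot (omega s ^ (2 * j)) (Z ^ t * F n)))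
      = of_nat s * (Z ^ t * Zbar ^ (s - 1) * Qp)"
    and "t < s \<Longrightarrow> (\<Sum>j<s. scale (omega s ^ (2 * j + 1)) (diff_quot (omega s ^ (2 * j + 1)) (Z ^ t * F n)))
      = - (of_nat s * (Z ^ t * Zbar ^ (s - 1) * Qm))"
proof -
  have c: "const 1 = 1" "const (- 1) = - 1" by (simp_all add: one_pCons)
  have r0: "reflect (omega s ^ (2 * j)) (F n) = const 1 * swap (F n)" for j
    using reflect_F[OF _ omega_even_power_s] by simp
  have r1: "reflect (omega s ^ (2 * j + 1)) (F n) = const ((- 1) ^ n) * swap (F n)" for j
    using reflect_F[OF _ omega_odd_power_s] by simp
  have q0: "(Z ^ s - const 1 * Zbar ^ s) * Qp = F n - const 1 * swap (F n)"
    using Qp unfolding c by simp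
  have q1: "(Z ^ s - const (- 1) * Zbar ^ s) * Qm = F n - const ((- 1) ^ n) * swap (F n)"
    using Qm unfolding c by simp
  note even = sum_diff_quot[where \<eta> = "\<lambda>j. omega s ^ (2 * j)", OF s_pos _ omega_even_power_s
      sum_omega_even_power r0 q0, simplified c mult_1_left]
  note odd = sum_diff_quot[where \<eta> = "\<lambda>j. omega s ^ (2 * j + 1)", OF s_pos _ omega_odd_power_s
      sum_omega_odd_power r1 q1, unfolded c]
  show "1 \<le> t \<Longrightarrow> t \<le> s \<Longrightarrow> (\<Sum>j<s. diff_quot (omega s ^ (2 * j)) (Z ^ t * F n))
      = of_nat s * Z ^ (t - 1) * (F n + Zbar ^ s * Qp)"
    by (rule even(1)) simp_all
  show "t < s \<Longrightarrow> (\<Sum>j<s. scale (omega s ^ (2 * j)) (diff_quot (omega s ^ (2 * j)) (Z ^ t * F n)))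
      = of_nat s * (Z ^ t * Zbar ^ (s - 1) * Qp)"
    by (rule even(2)) simp_all
  show "(\<Sum>j<s. diff_quot (omega s ^ (2 * j + 1)) (Z ^ t * F n))
      = of_nat s * Z ^ (t - 1) * (F n - Zbar ^ s * Qm)" if "1 \<le> t" "t \<le> s"
    by (subst odd(1)) (use that in simp_all)
  show "(\<Sum>j<s. scale (omega s ^ (2 * j + 1)) (diff_quot (omega s ^ (2 * j + 1)) (Z ^ t * F n)))
      = - (of_nat s * (Z ^ t * Zbar ^ (s - 1) * Qm))" if "t < s"
    by (subst odd(2)) (use that in simp_all)
qed

text \<open>After multiplication by z, the terms with \<open>Qp\<close> and \<open>Qm\<close> from
  the reflections cancel those that Euler's identity puts into z \<open>dz (F n)\<close>; the degree
  n s + t and \<gamma> remain.\<close>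

lemma T_Z_power_F:
  assumes t: "1 \<le> t" "t \<le> s"
  shows "T s \<kappa>0 \<kappa>1 (Z ^ t * F n) = scale (of_nat (n * s + t) + \<gamma>) (Z ^ (t - 1) * F n)"
proof -
  from F_quotients[of n] obtain Qp Qm where Q: "(Z ^ s - Zbar ^ s) * Qp = F n - swap (F n)"
    "(Z ^ s + Zbar ^ s) * Qm = F n - const ((- 1) ^ n) * swap (F n)"
    "Zbar * dzbar (F n) = of_nat s * Zbar ^ s * (const \<kappa>0 * Qp - const \<kappa>1 * Qm)" by blast
  have Zt: "Z * Z ^ (t - 1) = Z ^ t" using t by (cases t) simp_all
  define f where "f = F n"
  define k0 k1 where "k0 = const \<kappa>0" and "k1 = const \<kappa>1"
  have E: "Z * dz f = of_nat (n * s) * f - of_nat s * Zbar ^ s * (k0 * Qp - k1 * Qm)"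
    using euler_F[of n] unfolding Q(3) f_def k0_def k1_def by (simp only: eq_diff_eq)
  have c: "const (of_nat (n * s + t) + \<gamma>) = of_nat (n * s) + of_nat t + of_nat s * k0 + of_nat s * k1"
    unfolding \<gamma>_def const_add const_mult const_of_nat k0_def k1_def by simp
  have "Z * T s \<kappa>0 \<kappa>1 (Z ^ t * F n) = Z * dz (Z ^ t) * f + Z ^ t * (Z * dz f)
     + k0 * (of_nat s * (Z * Z ^ (t - 1)) * (f + Zbar ^ s * Qp))
     + k1 * (of_nat s * (Z * Z ^ (t - 1)) * (f - Zbar ^ s * Qm))"
    unfolding T_def dz_mult sum_diff_quot_F(1,2)[OF Q(1,2) t] scale_eq f_def k0_def k1_def
    by (simp only: distrib_left mult_ac)
  also have "\<dots> = (of_nat (n * s) + of_nat t + of_nat s * k0 + of_nat s * k1) * (Z ^ t * f)"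
    unfolding E dz_Z_power Zt by (simp only: ring_distribs mult_ac) (simp add: algebra_simps)
  also have "\<dots> = Z * scale (of_nat (n * s + t) + \<gamma>) (Z ^ (t - 1) * F n)"
    unfolding scale_eq c f_def Zt[symmetric] by (simp only: mult_ac)
  finally show ?thesis by (metis Z_nonzero mult_left_cancel)
qed

text \<open>After multiplication by zbar, the reflection terms are exactly z^t times the expression
  for zbar \<open>dzbar (F n)\<close> in \<open>F_quotients\<close>.\<close>

lemma Tbar_Z_power_F:
  assumes t: "t < s"
  shows "Tbar s \<kappa>0 \<kappa>1 (Z ^ t * F n) = 0"
proof -
  from F_quotients[of n] obtain Qp Qm where Q: "(Z ^ s - Zbar ^ s) * Qp = F n - swap (F n)"
    "(Z ^ s + Zbar ^ s) * Qm = F n - const ((- 1) ^ n) * swap (F n)"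
    "Zbar * dzbar (F n) = of_nat s * Zbar ^ s * (const \<kappa>0 * Qp - const \<kappa>1 * Qm)" by blast
  have Zs: "Zbar * Zbar ^ (s - 1) = Zbar ^ s" using s_pos by (cases s) simp_all
  have "Zbar * Tbar s \<kappa>0 \<kappa>1 (Z ^ t * F n) = Z ^ t * (Zbar * dzbar (F n))
     - const \<kappa>0 * (of_nat s * (Z ^ t * (Zbar * Zbar ^ (s - 1)) * Qp))
     - const \<kappa>1 * (- (of_nat s * (Z ^ t * (Zbar * Zbar ^ (s - 1)) * Qm)))"
    unfolding Tbar_def dzbar_mult sum_diff_quot_F(3,4)[OF Q(1,2) t] dzbar_Z_power
    unfolding scale_eq
    by (simp only: right_diff_distrib mult_ac mult_zero_left mult_zero_right add_0_left mult_minus_right)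
  also have "\<dots> = 0"
    unfolding Q(3) Zs by (simp only: right_diff_distrib mult_ac mult_minus_right) simp
  finally show ?thesis by simp
qed

subsection \<open>The images of the monomials\<close>

text \<open>\<open>harm N\<close> and \<open>swap (harm N)\<close> span the h-harmonic polynomials of degree \<open>N\<close>, i.e. those
  annihilated by \<open>T Tbar\<close>.\<close>

definition harm :: "nat \<Rightarrow> zpoly" where "harm N = Z ^ (N mod s) * F (N div s)"

definition mu :: "nat \<Rightarrow> complex" where "mu N = lam \<kappa>0 \<kappa>1 (N div s)"

lemma homogeneous_F: "homogeneous (n * s) (F n)"
proof (induction n)
  case 0
  show ?case by (simp add: F_0 homogeneous_1)
next
  case (Suc n)
  have "F (Suc n) = scale (recA \<kappa>0 \<kappa>1 (Suc n)) (Z ^ s * F n)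
      + scale (recB \<kappa>0 \<kappa>1 (Suc n)) (Zbar ^ s * swap (F n))"
    unfolding F_Suc A_def B_def by simp
  moreover have "homogeneous (s + n * s) (Z ^ s * F n)" "homogeneous (s + n * s) (Zbar ^ s * swap (F n))"
    using Suc by (simp_all add: homogeneous_Z_power homogeneous_Zbar_power homogeneous_swap)
  ultimately show ?case by (auto intro!: homogeneous_add homogeneous_scale)
qed

lemma homogeneous_harm: "homogeneous N (harm N)"
  using homogeneous_Z_power[OF homogeneous_F, of "N mod s" "N div s"]
  by (simp add: harm_def mod_div_mult_eq)

lemma T_swap_harm: "T s \<kappa>0 \<kappa>1 (swap (harm N)) = 0"
  unfolding T_swap[OF s_pos] harm_def using s_pos by (simp add: Tbar_Z_power_F)

text \<open>\<open>Z * harm N\<close> is z^t F n with t = N mod s + 1, which attains the boundary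
  value s when s divides N + 1.\<close>

lemma T_Z_harm: "T s \<kappa>0 \<kappa>1 (Z * harm N) = scale (of_nat (Suc N) + \<gamma>) (harm N)"
proof -
  have "Suc (N mod s) \<le> s" using s_pos by (simp add: Suc_leI)
  then have "T s \<kappa>0 \<kappa>1 (Z ^ Suc (N mod s) * F (N div s))
      = scale (of_nat (N div s * s + Suc (N mod s)) + \<gamma>) (Z ^ (Suc (N mod s) - 1) * F (N div s))"
    by (intro T_Z_power_F) simp_all
  then show ?thesis by (simp add: harm_def mult.assoc flip: of_nat_Suc)
qed

text \<open>In \<open>D\<close> one of \<open>harm\<close> and \<open>Z * harm\<close> occurs with and the other one without \<open>swap\<close>: \<open>Tbar\<close> kills
  the first summand and acts simply on the second one. In the equal expression \<open>D_swapped\<close> the same is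
  true of \<open>T\<close>.\<close>

definition D :: "nat \<Rightarrow> nat \<Rightarrow> nat \<Rightarrow> zpoly" where
  "D N a b = scale (mu N * coef (harm N) a b) (harm N)
    + (if N = 0 then 0 else
        scale (mu (N - 1) * coef (swap (Z * harm (N - 1))) a b) (swap (Z * harm (N - 1))))"

text \<open>If s does not divide N, then \<open>harm N\<close> is \<open>Z * harm (N - 1)\<close>
  with the same structural constant, and the two summands merely change places. If s divides N > 0,
  the recursion expresses \<open>harm N\<close> through \<open>P\<close> and its swap
  \<open>Q\<close>, and \<open>lam_Suc\<close> makes the two expressions equal.\<close>

lemma D_swapped: "D N a b = scale (mu N * coef (swap (harm N)) a b) (swap (harm N))
    + (if N = 0 then 0 else scale (mu (N - 1) * coef (Z * harm (N - 1)) a b) (Z * harm (N - 1)))"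
proof (cases "N mod s = 0")
  case False
  then obtain M where N: "N = Suc M" by (cases N) auto
  then have "N mod s = Suc (M mod s)" "N div s = M div s"
    using False by (simp_all add: mod_Suc div_Suc split: if_splits)
  then have "harm N = Z * harm M" "mu N = mu M" by (simp_all add: harm_def mu_def)
  then show ?thesis by (simp add: D_def N add.commute)
next
  case True
  then obtain n where n: "N = n * s" by (metis mod_0_imp_dvd dvdE mult.commute)
  show ?thesis
  proof (cases n)
    case 0
    then show ?thesis by (simp add: D_def n harm_def F_0)
  next
    case (Suc k)
    have N: "N \<noteq> 0" using n Suc s_pos by simp
    have km: "(k * s + i) div s = k" "(k * s + i) mod s = i" if "i < s" for i
      using that by simp_all
    have "N - 1 = k * s + (s - 1)" using s_pos by (simp add: n Suc)
    moreover have "(k * s + (s - 1)) div s = k" "(k * s + (s - 1)) mod s = s - 1"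
      by (rule km, use s_pos in simp)+
    ultimately have 1: "Z * harm (N - 1) = Z ^ s * F k" "mu (N - 1) = lam \<kappa>0 \<kappa>1 k"
      using s_pos by (simp_all add: harm_def mu_def flip: mult.assoc power_Suc)
    define P where "P = Z ^ s * F k"
    define Q where "Q = swap P"
    define \<alpha> \<beta> where "\<alpha> = recA \<kappa>0 \<kappa>1 (Suc k)" and "\<beta> = recB \<kappa>0 \<kappa>1 (Suc k)"
    define l where "l = lam \<kappa>0 \<kappa>1 (Suc k)"
    have h: "harm N = scale \<alpha> P + scale \<beta> Q" "mu N = l"
      using s_pos by (simp_all add: harm_def mu_def n Suc F_Suc A_def B_def P_def Q_def \<alpha>_def \<beta>_def l_def)
    have h': "swap (harm N) = scale \<alpha> Q + scale \<beta> P" unfolding h by (simp add: Q_def)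
    have l: "lam \<kappa>0 \<kappa>1 k = l * (\<alpha>\<^sup>2 - \<beta>\<^sup>2)"
      unfolding l_def \<alpha>_def \<beta>_def by (rule lam_Suc[symmetric]) (simp_all add: kappa_sum_nonzero kappa0_shift_nonzero kappa1_shift_nonzero)
    define p q where "p = coef P a b" and "q = coef Q a b"
    \<comment> \<open>The terms with \<beta>^2 cancel, and both sides become l (\<alpha>^2 (p P + q
      Q) + \<alpha> \<beta> (p Q + q P)).\<close>
    have "scale (l * (\<alpha> * p + \<beta> * q)) (scale \<alpha> P + scale \<beta> Q) + scale (l * (\<alpha>\<^sup>2 - \<beta>\<^sup>2) * q) Q
        = scale (l * (\<alpha> * q + \<beta> * p)) (scale \<alpha> Q + scale \<beta> P) + scale (l * (\<alpha>\<^sup>2 - \<beta>\<^sup>2) * p) P"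
      unfolding scale_eq const_add const_mult const_diff power2_eq_square by algebra
    then show ?thesis
      unfolding D_def 1 h' h(2) l P_def[symmetric] Q_def[symmetric] unfolding h(1)
      using N by (simp only: coef_add coef_scale p_def q_def if_False)
  qed
qed

lemma D_swap: "D N a b = swap (D N b a)"
  unfolding D_swapped[of N a b] D_def[of N b a] by (simp add: coef_swap del: swap_simps(5))

lemma homogeneous_D: "homogeneous N (D N a b)"
proof (cases N)
  case (Suc M)
  have "homogeneous (Suc M) (Z * harm M)"
    using homogeneous_Z_power[OF homogeneous_harm, of 1 M] by simp
  then show ?thesis
    unfolding D_def Suc
    by (auto intro!: homogeneous_add homogeneous_scale homogeneous_harm homogeneous_swap simp del: swap_simps(5))
qed (auto simp: D_def intro!: homogeneous_add homogeneous_scale homogeneous_harm homogeneous_0)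

section \<open>The candidates and the action of \<open>T\<close> and \<open>Tbar\<close> on
  them\<close>

definition w_coeff :: "nat \<Rightarrow> nat \<Rightarrow> nat \<Rightarrow> complex" where
  "w_coeff a b m = 1 / (fact m * pochhammer (\<gamma> + 1) (a + b - m))"

text \<open>\<open>w a b\<close> is the image of \<open>z^a zbar^b / (a! b!)\<close> under \<open>V\<close>.\<close>

definition w :: "nat \<Rightarrow> nat \<Rightarrow> zpoly" where
  "w a b = (\<Sum>m\<le>min a b. scale (w_coeff a b m) ((Z * Zbar) ^ m * D (a + b - 2 * m) (a - m) (b - m)))"

lemma w_swap: "w a b = swap (w b a)"
  unfolding w_def swap_simps
  by (simp add: D_swap[of _ "a - _"] w_coeff_def min.commute add.commute[of a] mult.commute[of Z]
      del: power_mult_distrib)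

lemma homogeneous_w: "homogeneous (a + b) (w a b)"
  unfolding w_def
proof (intro homogeneous_sum homogeneous_scale)
  fix m assume m: "m \<in> {..min a b}"
  have "homogeneous (m + (m + (a + b - 2 * m))) (Z ^ m * (Zbar ^ m * D (a + b - 2 * m) (a - m) (b - m)))"
    by (intro homogeneous_Z_power homogeneous_Zbar_power homogeneous_D)
  moreover have "m + (m + (a + b - 2 * m)) = a + b" using m by auto
  ultimately show "homogeneous (a + b) ((Z * Zbar) ^ m * D (a + b - 2 * m) (a - m) (b - m))"
    by (simp add: power_mult_distrib mult.assoc)
qed

lemma w_0_0: "w 0 0 = 1"
proof -
  have "lam \<kappa>0 \<kappa>1 0 = 1" by (simp add: lam_def)
  then show ?thesis
    using coef_const[of 1 0 0]
    by (simp add: w_def D_def w_coeff_def harm_def F_0 mu_def flip: one_pCons)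
qed

lemma T_ZZbar_power_mult:
  "T s \<kappa>0 \<kappa>1 ((Z * Zbar) ^ m * f)
    = of_nat m * Zbar * (Z * Zbar) ^ (m - 1) * f + (Z * Zbar) ^ m * T s \<kappa>0 \<kappa>1 f"
proof -
  have inv: "reflect \<eta> ((Z * Zbar) ^ m) = (Z * Zbar) ^ m" if "\<eta> \<noteq> 0" for \<eta>
    using that by (simp add: mult.commute)
  have dzm: "dz ((Z * Zbar) ^ m) = of_nat m * Zbar * (Z * Zbar) ^ (m - 1)"
  proof (induction m)
    case (Suc m)
    then show ?case by (cases m) (simp_all add: dz_mult algebra_simps)
  qed simp
  show ?thesis by (subst T_invariant_mult, rule inv, assumption, simp only: dzm)
qed

text \<open>The Pochhammer symbol in \<open>w_coeff\<close> absorbs the factor a + 1 + b - m +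
  \<gamma> that arises under \<open>T\<close>, just as the factorial absorbs the factor m from the
  derivative of (z zbar)^m.\<close>

lemma w_coeff_Suc_mult:
  assumes "m \<le> a" "m \<le> b"
  shows "w_coeff (Suc a) b m * (of_nat (Suc a + b - m) + \<gamma>) = w_coeff a b m"
proof -
  have *: "Suc a + b - m = Suc (a + b - m)" using assms by simp
  have "pochhammer (\<gamma> + 1) (Suc (a + b - m)) = (of_nat (Suc (a + b - m)) + \<gamma>) * pochhammer (\<gamma> + 1) (a + b - m)"
    by (simp add: pochhammer_rec' add_ac)
  then show ?thesis
    unfolding w_coeff_def * using gamma_shift_nonzero[of "Suc (a + b - m)"] by simp
qed

lemma w_coeff_Suc_Suc: "w_coeff (Suc a) b (Suc m) * of_nat (Suc m) = w_coeff a b m"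
  by (simp add: w_coeff_def del: of_nat_Suc)

text \<open>In the form \<open>D_swapped\<close>, \<open>T\<close> kills the swapped harmonic part,
  leaving the derivative of (z zbar)^m, and multiplies the other part by m + N + \<gamma> with N = a
  + 1 + b - 2m. For m = a + 1 the latter is absent, a multiple of \<open>Z\<close> having no terms
  of degree 0 in z.\<close>

lemma T_term:
  assumes m: "m \<le> Suc a" "m \<le> b"
  shows "T s \<kappa>0 \<kappa>1 ((Z * Zbar) ^ m * D (Suc a + b - 2 * m) (Suc a - m) (b - m))
    = scale (of_nat m * (mu (Suc a + b - 2 * m) * coef (swap (harm (Suc a + b - 2 * m))) (Suc a - m) (b - m)))
        ((Z * Zbar) ^ (m - 1) * (Zbar * swap (harm (Suc a + b - 2 * m))))
    + (if m \<le> a then scale ((of_nat (Suc a + b - m) + \<gamma>)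
          * (mu (a + b - 2 * m) * coef (harm (a + b - 2 * m)) (a - m) (b - m)))
        ((Z * Zbar) ^ m * harm (a + b - 2 * m)) else 0)"
proof -
  define N where "N = Suc a + b - 2 * m"
  define x where "x = Z * Zbar"
  define f where "f = swap (harm N)"
  define c where "c = mu N * coef f (Suc a - m) (b - m)"
  have Tf: "T s \<kappa>0 \<kappa>1 (x ^ m * f) = scale (of_nat m) (x ^ (m - 1) * (Zbar * f))"
    unfolding x_def T_ZZbar_power_mult f_def T_swap_harm scale_eq const_of_nat by (simp add: mult_ac)
  show ?thesis
  proof (cases "m \<le> a")
    case False
    then have "Suc a - m = 0" using m by simp
    then have "D N (Suc a - m) (b - m) = scale c f"
      unfolding D_swapped coef_Z_mult by (simp add: c_def f_def)
    then have "T s \<kappa>0 \<kappa>1 (x ^ m * D N (Suc a - m) (b - m)) = scale c (T s \<kappa>0 \<kappa>1 (x ^ m * f))"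
      by (simp only: mult_smult_right T_scale)
    then show ?thesis
      using False unfolding Tf N_def[symmetric] x_def[symmetric] f_def[symmetric]
      by (simp add: c_def mult.commute)
  next
    case True
    define M where "M = a + b - 2 * m"
    have N: "N = Suc M" "N \<noteq> 0" "N - 1 = M" "Suc a - m \<noteq> 0" "Suc a - m - 1 = a - m"
      using True m by (simp_all add: N_def M_def)
    define g where "g = harm M"
    define e where "e = mu M * coef g (a - m) (b - m)"
    have D: "D N (Suc a - m) (b - m) = scale c f + scale e (Z * g)"
      unfolding D_swapped coef_Z_mult using N by (simp add: c_def f_def e_def g_def)
    have "T s \<kappa>0 \<kappa>1 (x ^ m * (Z * g))
        = of_nat m * Zbar * x ^ (m - 1) * (Z * g) + x ^ m * scale (of_nat (Suc M) + \<gamma>) g"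
      unfolding x_def T_ZZbar_power_mult g_def T_Z_harm ..
    also have "of_nat m * Zbar * x ^ (m - 1) * (Z * g) = of_nat m * x ^ m * g"
      by (cases m) (simp_all add: x_def mult_ac)
    also have "of_nat m * x ^ m * g + x ^ m * scale (of_nat (Suc M) + \<gamma>) g
        = scale (of_nat m + (of_nat (Suc M) + \<gamma>)) (x ^ m * g)"
      unfolding scale_eq const_add const_of_nat by (simp only: distrib_right distrib_left mult_ac)
    also have "of_nat m + (of_nat (Suc M) + \<gamma>) = of_nat (Suc a + b - m) + \<gamma>"
    proof -
      have "m + Suc M = Suc a + b - m" using True m by (simp add: M_def)
      then show ?thesis by (metis add.assoc of_nat_add)
    qed
    finally have Tg: "T s \<kappa>0 \<kappa>1 (x ^ m * (Z * g)) = scale (of_nat (Suc a + b - m) + \<gamma>) (x ^ m * g)" .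
    have "T s \<kappa>0 \<kappa>1 (x ^ m * D N (Suc a - m) (b - m))
        = scale c (T s \<kappa>0 \<kappa>1 (x ^ m * f)) + scale e (T s \<kappa>0 \<kappa>1 (x ^ m * (Z * g)))"
      unfolding D by (simp only: distrib_left mult_smult_right T_scale T_add)
    then show ?thesis
      using True unfolding Tf Tg N_def[symmetric] M_def[symmetric] x_def[symmetric] f_def[symmetric] g_def[symmetric]
      by (simp add: c_def e_def mult.commute)
  qed
qed

text \<open>The term of index m + 1 leaves under \<open>T\<close> a piece \<open>X (Suc m)\<close>
  that carries (z zbar)^m. Together with \<open>Y m\<close> it makes up the term of index m of
  \<open>w a b\<close>, now in the original form of \<open>D\<close>.\<close>

lemma T_w_Suc: "T s \<kappa>0 \<kappa>1 (w (Suc a) b) = w a b"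
proof -
  define X where "X m = (if m \<le> Suc a then scale (w_coeff (Suc a) b m * of_nat m
      * (mu (Suc a + b - 2 * m) * coef (swap (harm (Suc a + b - 2 * m))) (Suc a - m) (b - m)))
        ((Z * Zbar) ^ (m - 1) * (Zbar * swap (harm (Suc a + b - 2 * m)))) else 0)" for m
  define Y where "Y m = (if m \<le> a then scale (w_coeff a b m
          * (mu (a + b - 2 * m) * coef (harm (a + b - 2 * m)) (a - m) (b - m)))
        ((Z * Zbar) ^ m * harm (a + b - 2 * m)) else 0)" for m
  \<comment> \<open>Extended by 0 beyond a', so that the sums for a and a + 1 both run over m \<le>
    b.\<close>
  define D' where "D' a' m = (if m \<le> a' then scale (w_coeff a' b m)
    ((Z * Zbar) ^ m * D (a' + b - 2 * m) (a' - m) (b - m)) else 0)" for a' m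
  have w: "w a' b = (\<Sum>m\<le>b. D' a' m)" for a'
    unfolding w_def D'_def by (intro sum.mono_neutral_cong_left) auto
  have ss: "scale c (scale d f) = scale (c * d) f" for c d f by (simp add: mult.commute)
  have "T s \<kappa>0 \<kappa>1 (D' (Suc a) m) = X m + Y m" if "m \<le> b" for m
  proof (cases "m \<le> Suc a")
    case True
    show ?thesis
    proof (cases "m \<le> a")
      case le: True
      show ?thesis
        unfolding D'_def X_def Y_def using True le
        by (simp only: if_True T_scale T_term[OF True that] smult_add_right ss mult.assoc[symmetric]
            w_coeff_Suc_mult[OF le that])
    next
      case False
      then show ?thesis
        unfolding D'_def X_def Y_def using True
        by (simp only: if_True if_False T_scale T_term[OF True that] smult_add_right ss mult.assoc[symmetric] smult_0_right)
    qed
  qed (simp add: D'_def X_def Y_def)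
  then have "T s \<kappa>0 \<kappa>1 (w (Suc a) b) = (\<Sum>m\<le>b. X m) + (\<Sum>m\<le>b. Y m)"
    by (simp add: w T_sum sum.distrib)
  moreover have "D' a m = Y m + (if m < b then X (Suc m) else 0)" if "m \<le> b" for m
  proof (cases "m \<le> a")
    case True
    define M where "M = a + b - 2 * m"
    have c: "coef (swap (Z * harm (M - 1))) (a - m) (b - m)
        = (if m < b then coef (swap (harm (M - 1))) (a - m) (b - Suc m) else 0)"
      unfolding swap_simps coef_Zbar_mult by simp
    have 1: "Suc a + b - 2 * Suc m = M - 1" using True by (simp add: M_def)
    have 2: "m < b \<Longrightarrow> M \<noteq> 0" using True by (simp add: M_def)
    show ?thesis
    proof (cases "m < b")
      case lt: True
      have "Suc m \<le> Suc a" using True by simp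
      with lt 2 True show ?thesis
        unfolding D'_def Y_def X_def D_def M_def[symmetric] c 1 w_coeff_Suc_Suc
        by (simp only: if_True if_False ss distrib_left mult_smult_right smult_add_right diff_Suc_1
            diff_Suc_Suc swap_simps)
    next
      case False
      with True show ?thesis
        unfolding D'_def Y_def X_def D_def M_def[symmetric] c
        by (simp only: if_True if_False mult_zero_right ss mult_smult_right) (simp add: mult_ac)
    qed
  qed (use that in \<open>simp add: D'_def X_def Y_def\<close>)
  then have "w a b = (\<Sum>m\<le>b. Y m) + (\<Sum>m\<le>b. if m < b then X (Suc m) else 0)"
    by (simp add: w sum.distrib)
  moreover have "(\<Sum>m\<le>b. if m < b then X (Suc m) else 0) = (\<Sum>m<b. X (Suc m))"
    by (intro sum.mono_neutral_cong_right) auto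
  moreover have "(\<Sum>m\<le>b. X m) = X 0 + (\<Sum>m<b. X (Suc m))"
    by (metis lessThan_Suc_atMost sum.lessThan_Suc_shift)
  moreover have "X 0 = 0" by (simp add: X_def)
  ultimately show ?thesis by simp
qed

lemma T_w_0: "T s \<kappa>0 \<kappa>1 (w 0 b) = 0"
  unfolding w_def by (simp add: D_swapped coef_Z_mult T_scale T_swap_harm)

lemma T_w: "T s \<kappa>0 \<kappa>1 (w a b) = (if a = 0 then 0 else w (a - 1) b)"
  by (cases a) (simp_all add: T_w_0 T_w_Suc)

lemma Tbar_w: "Tbar s \<kappa>0 \<kappa>1 (w a b) = (if b = 0 then 0 else w a (b - 1))"
  unfolding Tbar_eq[OF s_pos] w_swap[of b a, symmetric] T_w by (simp add: w_swap[symmetric])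

section \<open>Comparison with the intertwining operator\<close>

lemma Tbar_diff: "Tbar s \<kappa>0 \<kappa>1 (f - g) = Tbar s \<kappa>0 \<kappa>1 f - Tbar s \<kappa>0 \<kappa>1 g"
  and Tbar_scale: "Tbar s \<kappa>0 \<kappa>1 (scale c f) = scale c (Tbar s \<kappa>0 \<kappa>1 f)"
  unfolding Tbar_eq[OF s_pos] by (simp_all add: T_diff T_scale)

lemma dz_monomial: "dz (Z ^ a * Zbar ^ b) = scale (of_nat a) (Z ^ (a - 1) * Zbar ^ b)"
proof -
  have "dz (Z ^ a) = scale (of_nat a) (Z ^ (a - 1))"
  proof (cases a)
    case (Suc k)
    then have "Z * dz (Z ^ a) = Z * scale (of_nat a) (Z ^ (a - 1))"
      unfolding dz_Z_power scale_eq const_of_nat by (simp add: mult_ac)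
    then show ?thesis by (metis Z_nonzero mult_left_cancel)
  qed (simp flip: one_pCons)
  then show ?thesis by (simp add: dz_mult)
qed

lemma dzbar_monomial: "dzbar (Z ^ a * Zbar ^ b) = scale (of_nat b) (Z ^ a * Zbar ^ (b - 1))"
  using arg_cong[OF dz_monomial[of b a], of swap] by (simp add: swap_dz mult.commute)

text \<open>Induction on a + b: by the induction hypothesis \<open>T\<close> and \<open>Tbar\<close>
  annihilate the difference of the two sides, which is homogeneous of positive degree and therefore
  0.\<close>

lemma V_monomial:
  assumes V: "intertwining s \<kappa>0 \<kappa>1 V"
  shows "V (Z ^ a * Zbar ^ b) = scale (fact a * fact b) (w a b)"
proof (induction "a + b" arbitrary: a b)
  case 0
  then show ?case using V by (simp add: intertwining_def w_0_0 flip: one_pCons)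
next
  case (Suc n)
  interpret V: Vector_Spaces.linear scale scale V
    using V by (simp add: intertwining_def)
  define f where "f = V (Z ^ a * Zbar ^ b) - scale (fact a * fact b) (w a b)"
  have "f = V (Z ^ a * Zbar ^ b) + scale (- (fact a * fact b)) (w a b)"
    by (simp add: f_def flip: minus_pCons)
  moreover have "homogeneous (a + b) (V (Z ^ a * Zbar ^ b))"
    using V homogeneous_monomial by (simp add: intertwining_def)
  ultimately have "homogeneous (a + b) f"
    by (simp only:) (intro homogeneous_add homogeneous_scale homogeneous_w)
  moreover have "T s \<kappa>0 \<kappa>1 f = 0"
  proof (cases a)
    case 0
    have "T s \<kappa>0 \<kappa>1 (V (Z ^ a * Zbar ^ b)) = V (dz (Z ^ a * Zbar ^ b))"
      using V by (simp add: intertwining_def)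
    then show ?thesis by (simp only: f_def T_diff T_scale T_w dz_monomial 0) (simp add: V.zero)
  next
    case (Suc k)
    have "T s \<kappa>0 \<kappa>1 (V (Z ^ a * Zbar ^ b)) = V (dz (Z ^ a * Zbar ^ b))"
      using V by (simp add: intertwining_def)
    also have "\<dots> = scale (of_nat a) (scale (fact k * fact b) (w k b))"
      unfolding dz_monomial V.scale using Suc.hyps(1)[of k b] Suc Suc.hyps(2) by simp
    finally show ?thesis
      by (simp add: f_def T_diff T_scale T_w Suc mult_ac del: of_nat_Suc flip: of_nat_Suc)
  qed
  moreover have "Tbar s \<kappa>0 \<kappa>1 f = 0"
  proof (cases b)
    case 0
    have "Tbar s \<kappa>0 \<kappa>1 (V (Z ^ a * Zbar ^ b)) = V (dzbar (Z ^ a * Zbar ^ b))"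
      using V by (simp add: intertwining_def)
    then show ?thesis by (simp only: f_def Tbar_diff Tbar_scale Tbar_w dzbar_monomial 0) (simp add: V.zero)
  next
    case (Suc k)
    have "Tbar s \<kappa>0 \<kappa>1 (V (Z ^ a * Zbar ^ b)) = V (dzbar (Z ^ a * Zbar ^ b))"
      using V by (simp add: intertwining_def)
    also have "\<dots> = scale (of_nat b) (scale (fact a * fact k) (w a k))"
      unfolding dzbar_monomial V.scale using Suc.hyps(1)[of a k] Suc Suc.hyps(2) by simp
    finally show ?thesis
      by (simp add: f_def Tbar_diff Tbar_scale Tbar_w Suc mult_ac del: of_nat_Suc flip: of_nat_Suc)
  qed
  ultimately have "f = 0"
    using intertwining_kernel[OF V] Suc.hyps(2) by (metis One_nat_def Suc_le_mono le0)
  then show ?case by (simp add: f_def)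
qed

section \<open>The explicit form of \<open>w a b\<close>\<close>

lemma coef_harm: "coef (harm (n * s + t)) i j
  = (if t \<le> i \<and> s dvd i - t \<and> s dvd j then coef (f_poly \<kappa>0 \<kappa>1 n) ((i - t) div s) (j div s) else 0)"
  if "t < s"
  using that s_pos by (simp add: harm_def coef_Z_power_mult F_def coef_subst_powers)

lemma coef_Z_harm: "coef (Z * harm (n * s + t)) i j
  = (if Suc t \<le> i \<and> s dvd i - Suc t \<and> s dvd j
     then coef (f_poly \<kappa>0 \<kappa>1 n) ((i - Suc t) div s) (j div s) else 0)"
  if "t < s"
  by (cases i) (simp_all add: coef_Z_mult coef_harm that)

lemma swap_F: "swap (F n) = subst (f_poly \<kappa>0 \<kappa>1 n) (Zbar ^ s) (Z ^ s)"
  by (simp add: F_def swap_def subst_subst)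

lemma w_coeff_eq: "w_coeff a b m
    = 1 / (fact m * pochhammer (of_nat s * \<kappa>0 + of_nat s * \<kappa>1 + 1) (a + b - m))"
  by (simp add: w_coeff_def \<gamma>_def)

text \<open>The two sums come from the two summands of \<open>D\<close>. As a > b, the degree a + b
  - 2m is positive for all m \<le> b, so that the second summand is always present.\<close>

lemma w_split:
  assumes "a > b"
  shows "w a b =
      (\<Sum>m\<le>b. scale (w_coeff a b m * (mu (a + b - 2 * m) * coef (harm (a + b - 2 * m)) (a - m) (b - m)))
        ((Z * Zbar) ^ m * harm (a + b - 2 * m)))
    + (\<Sum>m\<le>b. scale (w_coeff a b m * (mu (a + b - 2 * m - 1)
          * coef (Z * harm (a + b - 2 * m - 1)) (b - m) (a - m)))
        ((Z * Zbar) ^ m * swap (Z * harm (a + b - 2 * m - 1))))"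
proof -
  have ss: "scale c (scale d f) = scale (c * d) f" for c d f by (simp add: mult.commute)
  have "min a b = b" "a + b - 2 * m \<noteq> 0" if "m \<le> b" for m
    using assms that by simp_all
  then show ?thesis
    unfolding w_def sum.distrib[symmetric] using assms
    by (intro sum.cong) (simp_all only: min.absorb2 less_imp_le D_def coef_swap if_False atMost_iff
        distrib_left mult_smult_right smult_add_right ss)
qed

text \<open>The coefficients vanish unless s divides b - m in the first sum and a - m in the second
  one, which restricts m to the values k s + r and (k - 1) s + r + t respectively.\<close>

lemma w_explicit:
  fixes a b t u v r :: nat
  assumes ab: "a > b" and t: "1 \<le> t" "t < s" and b: "b = v * s + r" and r: "r < s"
    and a: "a = u * s + r + t"
  shows "w a b =
      (\<Sum>k = 0..v. scale
           (lam \<kappa>0 \<kappa>1 (u + v - 2*k) * coef (f_poly \<kappa>0 \<kappa>1 (u + v - 2*k)) (u - k) (v - k)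
            / (fact (k*s + r)
               * pochhammer (of_nat s * \<kappa>0 + of_nat s * \<kappa>1 + 1) (a + (v - k) * s)))
           ((Z * Zbar) ^ (k*s + r) * Z ^ t
            * subst (f_poly \<kappa>0 \<kappa>1 (u + v - 2*k)) (Z ^ s) (Zbar ^ s)))
    + (\<Sum>k = 1 - (r + t) div s..v. scale
           (lam \<kappa>0 \<kappa>1 (u + v + 1 - 2*k)
            * coef (f_poly \<kappa>0 \<kappa>1 (u + v + 1 - 2*k)) (v - k) (u - k + 1)
            / (fact (k*s + r + t - s)
               * pochhammer (of_nat s * \<kappa>0 + of_nat s * \<kappa>1 + 1) (b + (u - k + 1) * s)))
           ((Z * Zbar) ^ (k*s + r + t - s) * Zbar ^ (s - t)
            * subst (f_poly \<kappa>0 \<kappa>1 (u + v + 1 - 2*k)) (Zbar ^ s) (Z ^ s)))"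
    (is "_ = sum ?R1 _ + sum ?R2 _")
proof -
  \<comment> \<open>This makes u - k a true difference for every k \<le> v.\<close>
  have uv: "v \<le> u"
  proof (rule ccontr)
    assume "\<not> v \<le> u"
    then have "Suc u * s \<le> v * s" by (intro mult_le_mono1) simp
    then show False using ab t unfolding a b by simp
  qed
  have pos: "0 < s" using s_pos .
  define L1 where "L1 m = scale (w_coeff a b m * (mu (a + b - 2 * m)
      * coef (harm (a + b - 2 * m)) (a - m) (b - m))) ((Z * Zbar) ^ m * harm (a + b - 2 * m))" for m
  define L2 where "L2 m = scale (w_coeff a b m * (mu (a + b - 2 * m - 1)
      * coef (Z * harm (a + b - 2 * m - 1)) (b - m) (a - m)))
        ((Z * Zbar) ^ m * swap (Z * harm (a + b - 2 * m - 1)))" for m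
  have coef_harm_0: "coef (harm N) i j = 0" "coef (Z * harm N) i j = 0" if "\<not> s dvd j" for N i j
    using coef_harm[of "N mod s" "N div s" i j] coef_Z_harm[of "N mod s" "N div s" i j] that pos
    by simp_all

  have "(\<Sum>m\<le>b. L1 m) = (\<Sum>m\<in>(\<lambda>k. k * s + r) ` {0..v}. L1 m)"
  proof (rule sum.mono_neutral_right)
    show "(\<lambda>k. k * s + r) ` {0..v} \<subseteq> {..b}" by (auto simp: b)
    show "\<forall>m\<in>{..b} - (\<lambda>k. k * s + r) ` {0..v}. L1 m = 0"
    proof
      fix m assume m: "m \<in> {..b} - (\<lambda>k. k * s + r) ` {0..v}"
      have "\<not> s dvd b - m"
      proof
        assume "s dvd b - m"
        then obtain j where j: "b - m = j * s" by (metis dvdE mult.commute)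
        then have mj: "m + j * s = v * s + r" using m b by (simp only: Diff_iff atMost_iff) linarith
        have "j \<le> v"
        proof (rule ccontr)
          assume "\<not> j \<le> v"
          then have "Suc v * s \<le> j * s" by (intro mult_le_mono1) simp
          then show False using mj r by simp
        qed
        then have "m = (v - j) * s + r" using mj by (simp add: diff_mult_distrib)
        then show False using m by auto
      qed
      then show "L1 m = 0" by (simp add: L1_def coef_harm_0)
    qed
  qed simp
  also have "\<dots> = (\<Sum>k=0..v. L1 (k * s + r))"
    using pos by (subst sum.reindex) (auto simp: inj_on_def)
  also have "\<dots> = sum ?R1 {0..v}"
  proof (rule sum.cong)
    fix k assume "k \<in> {0..v}"
    then obtain p where p: "v = k + p" using le_Suc_ex by auto
    obtain q where q: "u = k + p + q" using uv p le_Suc_ex by blast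
    have N: "a + b - 2 * (k * s + r) = (u + v - 2 * k) * s + t"
      by (simp add: a b p q algebra_simps)
    have am: "a - (k * s + r) = (u - k) * s + t" and bm: "b - (k * s + r) = (v - k) * s"
      and abm: "a + b - (k * s + r) = a + (v - k) * s"
      by (simp_all add: a b p q algebra_simps)
    have c: "coef (harm (a + b - 2 * (k * s + r))) (a - (k * s + r)) (b - (k * s + r))
        = coef (f_poly \<kappa>0 \<kappa>1 (u + v - 2*k)) (u - k) (v - k)"
      unfolding N am bm using t pos by (simp add: coef_harm)
    have h: "harm (a + b - 2 * (k * s + r))
        = Z ^ t * subst (f_poly \<kappa>0 \<kappa>1 (u + v - 2*k)) (Z ^ s) (Zbar ^ s)"
      and mu: "mu (a + b - 2 * (k * s + r)) = lam \<kappa>0 \<kappa>1 (u + v - 2*k)"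
      unfolding N harm_def mu_def F_def using t by simp_all
    show "L1 (k * s + r) = ?R1 k"
      unfolding L1_def c unfolding h mu w_coeff_eq abm by (simp add: mult.assoc)
  qed simp
  finally have 1: "(\<Sum>m\<le>b. L1 m) = sum ?R1 {0..v}" .

  define K where "K = {1 - (r + t) div s..v}"
  have K: "k \<in> K \<longleftrightarrow> k \<le> v \<and> s \<le> k * s + r + t" for k
  proof (cases k)
    case 0
    show ?thesis using pos by (auto simp: K_def 0 Suc_le_eq div_greater_zero_iff)
  qed (auto simp: K_def)
  have "(\<Sum>m\<le>b. L2 m) = (\<Sum>m\<in>(\<lambda>k. k * s + r + t - s) ` K. L2 m)"
  proof (rule sum.mono_neutral_right)
    show "(\<lambda>k. k * s + r + t - s) ` K \<subseteq> {..b}"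
    proof clarsimp
      fix k assume "k \<in> K"
      then have "k * s \<le> v * s" by (simp add: K)
      then show "k * s + r + t - s \<le> b" using t unfolding b by linarith
    qed
    show "\<forall>m\<in>{..b} - (\<lambda>k. k * s + r + t - s) ` K. L2 m = 0"
    proof
      fix m assume m: "m \<in> {..b} - (\<lambda>k. k * s + r + t - s) ` K"
      have "\<not> s dvd a - m"
      proof
        assume "s dvd a - m"
        then obtain j where j: "a - m = j * s" by (metis dvdE mult.commute)
        then have mj: "m + j * s = u * s + r + t" using m ab a by (simp only: Diff_iff atMost_iff) linarith
        have ju: "j \<le> Suc u"
        proof (rule ccontr)
          assume "\<not> j \<le> Suc u"
          then have "Suc (Suc u) * s \<le> j * s" by (intro mult_le_mono1) simp
          then show False using mj r t by simp
        qed
        \<comment> \<open>Solves m = (k - 1) s + r + t, given m + j s = u s + r + t.\<close>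
        define k where "k = Suc u - j"
        have "k * s + j * s = u * s + s" using ju by (simp add: k_def flip: add_mult_distrib)
        then have mk: "m + s = k * s + r + t" using mj by simp
        have "k \<le> v"
        proof (rule ccontr)
          assume "\<not> k \<le> v"
          then have "Suc v * s \<le> k * s" by (intro mult_le_mono1) simp
          then show False using mk m t by (simp add: b)
        qed
        then have "k \<in> K" using mk by (simp add: K flip: mk)
        moreover have "m = k * s + r + t - s" using mk by simp
        ultimately show False using m by blast
      qed
      then show "L2 m = 0" by (simp add: L2_def coef_harm_0)
    qed
  qed simp
  also have "\<dots> = (\<Sum>k\<in>K. L2 (k * s + r + t - s))"
  proof (subst sum.reindex)
    show "inj_on (\<lambda>k. k * s + r + t - s) K"
    proof (rule inj_onI)
      fix k l assume "k \<in> K" "l \<in> K" "k * s + r + t - s = l * s + r + t - s"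
      then have "k * s = l * s" unfolding K by linarith
      then show "k = l" using pos by simp
    qed
  qed simp
  also have "\<dots> = sum ?R2 K"
  proof (rule sum.cong)
    fix k assume "k \<in> K"
    then obtain p where p: "v = k + p" and k: "s \<le> k * s + r + t" using le_Suc_ex by (auto simp: K)
    obtain q where q: "u = k + p + q" using uv p le_Suc_ex by blast
    define m where "m = k * s + r + t - s"
    \<comment> \<open>The degree a + b - 2m is congruent to s - t modulo s, so one less has residue
      t'; the factor \<open>Z\<close> restores the exponent s - t.\<close>
    define t' where "t' = s - t - 1"
    have m: "m + s = k * s + r + t" and t': "Suc t' = s - t" "t' + Suc t = s"
      using k t by (simp_all add: m_def t'_def)
    have A: "a = m + (u - k + 1) * s" and B: "b = m + (v - k) * s + Suc t'"
      using m t' by (simp_all add: a b p q algebra_simps)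
    have am: "a - m = (u - k + 1) * s" and bm: "b - m = (v - k) * s + Suc t'"
      and abm: "a + b - m = b + (u - k + 1) * s" and "a + b - 2 * m = (u - k + 1) * s + (v - k) * s + Suc t'"
      using A B by simp_all
    moreover have "(u - k + 1) * s + (v - k) * s = (u + v + 1 - 2 * k) * s"
      by (simp add: p q algebra_simps)
    ultimately have N: "a + b - 2 * m - 1 = (u + v + 1 - 2 * k) * s + t'" by simp
    have lt: "t' < s" using t' t by simp
    have c: "coef (Z * harm (a + b - 2 * m - 1)) (b - m) (a - m)
        = coef (f_poly \<kappa>0 \<kappa>1 (u + v + 1 - 2*k)) (v - k) (u - k + 1)"
      unfolding N am bm coef_Z_harm[OF lt] using pos by simp
    have h: "swap (Z * harm (a + b - 2 * m - 1))
        = Zbar ^ (s - t) * subst (f_poly \<kappa>0 \<kappa>1 (u + v + 1 - 2*k)) (Zbar ^ s) (Z ^ s)"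
      and mu: "mu (a + b - 2 * m - 1) = lam \<kappa>0 \<kappa>1 (u + v + 1 - 2*k)"
      unfolding N harm_def mu_def swap_F[symmetric] t'(1)[symmetric] using lt by (simp_all add: mult.assoc)
    show "L2 (k * s + r + t - s) = ?R2 k"
      unfolding L2_def m_def[symmetric] c unfolding h mu w_coeff_eq abm by (simp add: mult.assoc)
  qed simp
  finally have 2: "(\<Sum>m\<le>b. L2 m) = sum ?R2 K" .
  have "w a b = (\<Sum>m\<le>b. L1 m) + (\<Sum>m\<le>b. L2 m)"
    unfolding w_split[OF ab] L1_def L2_def ..
  then show ?thesis unfolding 1 2 K_def .
qed

end

theorem theorem1:
  fixes s a b t u v r :: nat and \<kappa>0 \<kappa>1 :: complex and V :: "zpoly \<Rightarrow> zpoly"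
  assumes "s \<ge> 2"
    and "\<And>m::nat. m \<ge> 1 \<Longrightarrow> - \<kappa>0 + 1/2 \<noteq> of_nat m"
    and "\<And>m::nat. m \<ge> 1 \<Longrightarrow> - \<kappa>1 + 1/2 \<noteq> of_nat m"
    and "\<And>m::nat. m \<ge> 1 \<Longrightarrow> - of_nat s * (\<kappa>0 + \<kappa>1) \<noteq> of_nat m"
    and "intertwining s \<kappa>0 \<kappa>1 V"
    and "a > b"
    and "(a - b) mod s = t mod s" and "1 \<le> t" and "t < s"
    and "b = v * s + r" and "r < s"
    and "a = u * s + r + t"
  shows "V (Z ^ a * Zbar ^ b) =
      scale (fact a * fact b)
        (\<Sum>k = 0..v. scale
           (lam \<kappa>0 \<kappa>1 (u + v - 2*k) * coef (f_poly \<kappa>0 \<kappa>1 (u + v - 2*k)) (u - k) (v - k)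
            / (fact (k*s + r)
               * pochhammer (of_nat s * \<kappa>0 + of_nat s * \<kappa>1 + 1) (a + (v - k) * s)))
           ((Z * Zbar) ^ (k*s + r) * Z ^ t
            * subst (f_poly \<kappa>0 \<kappa>1 (u + v - 2*k)) (Z ^ s) (Zbar ^ s)))
    + scale (fact a * fact b)
        (\<Sum>k = 1 - (r + t) div s..v. scale
           (lam \<kappa>0 \<kappa>1 (u + v + 1 - 2*k)
            * coef (f_poly \<kappa>0 \<kappa>1 (u + v + 1 - 2*k)) (v - k) (u - k + 1)
            / (fact (k*s + r + t - s)
               * pochhammer (of_nat s * \<kappa>0 + of_nat s * \<kappa>1 + 1) (b + (u - k + 1) * s)))
           ((Z * Zbar) ^ (k*s + r + t - s) * Zbar ^ (s - t)
            * subst (f_poly \<kappa>0 \<kappa>1 (u + v + 1 - 2*k)) (Zbar ^ s) (Z ^ s)))"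
proof -
  interpret dihedral s \<kappa>0 \<kappa>1
    using assms(1-4) by unfold_locales
  show ?thesis
    unfolding V_monomial[OF assms(5)] w_explicit[OF assms(6,8-12)] by (rule smult_add_right)
qed

end
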